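(* Let $k\geq 3$ be a fixed integer. There is a finite set $E$ of composite positive integers (depending on $k$) such that, for every positive integer $v\notin E$, every cyclic $(v,k,1)$-design without short orbits (with point set identified with $\mathbb{Z}_v$) is generated by a $(v,k,1)$-DDF.
   Context: A $(v,k,\lambda)$-design is a pair $(V,\mathcal{B})$ where $V$ is a set of $v$ points and $\mathcal{B}$ is a collection of $k$-subsets of $V$ called blocks, such that every pair of distinct elements of $V$ is contained in precisely $\lambda$ blocks of $\mathcal{B}$. An automorphism is a permutation of $V$ leaving $\mathcal{B}$ invariant. The design is cyclic if it admits an automorphism consisting of a single cycle of length $v$; we then identify $V$ with $\mathbb{Z}_v$ so that $\mathcal{B}$ is invariant under all translations $B\mapsto B+t$, $t\in\mathbb{Z}_v$. The orbit of a block $B$ is $\{B+t : t\in\mathbb{Z}_v\}$; it is full if it has cardinality $v$, and short otherwise. A $(v,k,\lambda)$-cyclic difference family ($(v,k,\lambda)$-CDF) is a family $\mathcal{F}$ of $k$-subsets (called base blocks) of $\mathbb{Z}_v$ such that the multiset $\{x-y : x,y\in F,\ x\neq y,\ F\in\mathcal{F}\}$ contains every element of $\mathbb{Z}_v\setminus\{0\}$ exactly $\lambda$ times. A $(v,k,\lambda)$-DDF (disjoint difference family) is a $(v,k,\lambda)$-CDF whose base blocks are mutually disjoint. A cyclic design $(\mathbb{Z}_v,\mathcal{B})$ is generated by $\mathcal{F}$ if $\mathcal{B}$ equals the multiset $\{F+t : F\in\mathcal{F},\ t\in\mathbb{Z}_v\}$. *)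

theory Defs
  imports "HOL-Library.Multiset" "HOL-Computational_Algebra.Primes"
begin

text \<open>
  Collections of blocks and families of base blocks are multisets, so that repeated blocks are
  counted with multiplicity.
\<close>

definition design :: "nat \<Rightarrow> nat \<Rightarrow> nat \<Rightarrow> 'a set \<Rightarrow> 'a set multiset \<Rightarrow> bool" where
  "design v k l V \<B> \<longleftrightarrow>
     finite V \<and> card V = v \<and>
     (\<forall>B\<in>#\<B>. B \<subseteq> V \<and> card B = k) \<and>
     (\<forall>x\<in>V. \<forall>y\<in>V. x \<noteq> y \<longrightarrow> size {#B \<in># \<B>. x \<in> B \<and> y \<in> B#} = l)"

definition design_automorphism :: "'a set \<Rightarrow> 'a set multiset \<Rightarrow> ('a \<Rightarrow> 'a) \<Rightarrow> bool" where
  "design_automorphism V \<B> f \<longleftrightarrow> bij_betw f V V \<and> image_mset ((`) f) \<B> = \<B>"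

text \<open>The integers modulo \<open>v\<close> (for \<open>v > 0\<close>) are represented by their least nonnegative residues.\<close>

definition Zmod :: "nat \<Rightarrow> int set" where
  "Zmod v = {0..<int v}"

definition translate :: "nat \<Rightarrow> int \<Rightarrow> int \<Rightarrow> int" where
  "translate v t x = (x + t) mod int v"

definition cyclic_design :: "nat \<Rightarrow> nat \<Rightarrow> nat \<Rightarrow> int set multiset \<Rightarrow> bool" where
  "cyclic_design v k l \<B> \<longleftrightarrow>
     design v k l (Zmod v) \<B> \<and>
     (\<forall>t\<in>Zmod v. design_automorphism (Zmod v) \<B> (translate v t))"

definition block_orbit :: "nat \<Rightarrow> int set \<Rightarrow> int set set" where
  "block_orbit v B = {translate v t ` B | t. t \<in> Zmod v}"

definition full_orbit :: "nat \<Rightarrow> int set \<Rightarrow> bool" where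
  "full_orbit v B \<longleftrightarrow> card (block_orbit v B) = v"

definition differences :: "nat \<Rightarrow> int set multiset \<Rightarrow> int multiset" where
  "differences v \<F> =
     (\<Sum>F\<in>#\<F>. {#(x - y) mod int v. (x, y) \<in># mset_set {(x, y). x \<in> F \<and> y \<in> F \<and> x \<noteq> y}#})"

definition cyclic_difference_family :: "nat \<Rightarrow> nat \<Rightarrow> nat \<Rightarrow> int set multiset \<Rightarrow> bool" where
  "cyclic_difference_family v k l \<F> \<longleftrightarrow>
     (\<forall>F\<in>#\<F>. F \<subseteq> Zmod v \<and> card F = k) \<and>
     (\<forall>d\<in>Zmod v - {0}. count (differences v \<F>) d = l)"

text \<open>Only one copy of \<open>F\<close> is removed below, so two equal members of the family must be disjoint too.\<close>

definition disjoint_difference_family :: "nat \<Rightarrow> nat \<Rightarrow> nat \<Rightarrow> int set multiset \<Rightarrow> bool" where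
  "disjoint_difference_family v k l \<F> \<longleftrightarrow>
     cyclic_difference_family v k l \<F> \<and> (\<forall>F\<in>#\<F>. \<forall>G\<in>#\<F> - {#F#}. F \<inter> G = {})"

definition generated_by :: "nat \<Rightarrow> int set multiset \<Rightarrow> int set multiset \<Rightarrow> bool" where
  "generated_by v \<B> \<F> \<longleftrightarrow> \<B> = (\<Sum>F\<in>#\<F>. {#translate v t ` F. t \<in># mset_set (Zmod v)#})"

end

theory Submission
  imports Defs "HOL-Library.FuncSet" "HOL-Library.Disjoint_Sets" Complex_Main
begin

text \<open>
  One block has to be chosen from each of the \<open>n = (v - 1) / (k (k - 1))\<close> orbits so that the chosen
  blocks are disjoint.

  For \<open>v = p\<close> prime this is the polynomial method of Karasev and Petrov, carried out over the integers.
  If no choice of shifts \<open>t\<close> works, then \<open>p\<close> divides, for every \<open>t\<close>, a product \<open>f t\<close> of factors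
  \<open>t i - t j + c\<close>, with the same number \<open>2 m\<close> of factors for each pair \<open>i < j\<close>. Taking the \<open>d\<close>-th finite
  difference in each of the \<open>n\<close> variables, where \<open>d = m (n - 1)\<close>, kills everything of degree below
  \<open>n d = deg f\<close>, so it does not see the constants \<open>c\<close>. Replacing them by \<open>-m + 1, \<dots>, m\<close> gives a product
  that is nonzero at a single point of the grid \<open>{0..d}\<^sup>n\<close>, where it is not divisible by \<open>p\<close>; a contradiction.

  For large \<open>v\<close>, take \<open>k - 1\<close> copies of each orbit and the hypergraph on copies and points whose edges
  are a copy together with a block of its orbit. It is almost regular with bounded codegrees, so the
  Roedl nibble gives an almost perfect matching: nearly every orbit gets two blocks, all of them
  disjoint. The few remaining orbits are served greedily by blocks that damage at most one of the
  two blocks of each other orbit; that orbit then uses the undamaged one.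
\<close>

section \<open>Prime order\<close>

text \<open>Plain greedy choice fails by a constant factor: n disjoint blocks occupy k n points,
  each point lies in k of the v blocks of an orbit, and k^2 n = k (v - 1) / (k - 1) may exhaust an
  orbit. A near perfect matching on the copies does not remove this obstruction: it uses up almost
  all points, so each leftover orbit has to take points away from others. Holding a second block per
  orbit in reserve is the slack that makes this harmless. The hypothesis k >= 3 is what both
  arguments live on: it gives m n < p in the prime case, and at least two copies of each orbit in
  the other. The prime case has no lower bound on v, which is why the exceptional set can consist of
  composite numbers only, namely those below the threshold of the second argument.\<close>

lemma alternating_sum_Suc:
  fixes f :: "nat \<Rightarrow> int"
  shows "(\<Sum>x\<le>Suc d. (-1)^(Suc d - x) * int (Suc d choose x) * f x) =
         (\<Sum>x\<le>d. (-1)^(d - x) * int (d choose x) * (f (Suc x) - f x))"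
proof -
  let ?w = "\<lambda>d x. (-1)^(d - x) * int (d choose x)"
  have "(\<Sum>x\<le>Suc d. ?w (Suc d) x * f x) = ?w (Suc d) 0 * f 0 + (\<Sum>x\<le>d. ?w (Suc d) (Suc x) * f (Suc x))"
    by (simp only: sum.atMost_Suc_shift)
  also have "(\<Sum>x\<le>d. ?w (Suc d) (Suc x) * f (Suc x)) =
      (\<Sum>x\<le>d. ?w d x * f (Suc x)) + (\<Sum>x\<le>d. (-1)^(d - x) * int (d choose Suc x) * f (Suc x))"
    by (simp add: algebra_simps sum.distrib)
  also have "(\<Sum>x\<le>d. (-1)^(d - x) * int (d choose Suc x) * f (Suc x)) =
      (\<Sum>x<d. (-1)^(d - x) * int (d choose Suc x) * f (Suc x))"
    by (simp add: lessThan_Suc_atMost[symmetric])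
  also have "\<dots> = - (\<Sum>x<d. ?w d (Suc x) * f (Suc x))"
    unfolding sum_negf[symmetric]
  proof (rule sum.cong, simp)
    fix x assume "x \<in> {..<d}"
    then have "d - x = Suc (d - Suc x)" by auto
    then show "(-1)^(d - x) * int (d choose Suc x) * f (Suc x) = - (?w d (Suc x) * f (Suc x))"
      by simp
  qed
  also have "(\<Sum>x<d. ?w d (Suc x) * f (Suc x)) = (\<Sum>x\<le>d. ?w d x * f x) - ?w d 0 * f 0"
    unfolding lessThan_Suc_atMost[symmetric] sum.lessThan_Suc_shift by simp
  finally show ?thesis by (simp add: algebra_simps sum_subtractf)
qed

text \<open>One difference is split off by \<open>alternating_sum_Suc\<close>. It lowers the degree,
  because the leading terms of (x + 1)^a and x^a cancel in the binomial expansion.\<close>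

lemma alternating_sum_power:
  "a < d \<Longrightarrow> (\<Sum>x\<le>d. (-1)^(d - x) * int (d choose x) * int x ^ a) = 0"
proof (induction d arbitrary: a)
  case (Suc d)
  have "(\<Sum>x\<le>Suc d. (-1)^(Suc d - x) * int (Suc d choose x) * int x ^ a) =
      (\<Sum>x\<le>d. (-1)^(d - x) * int (d choose x) * (int (Suc x) ^ a - int x ^ a))"
    by (rule alternating_sum_Suc)
  also have "\<dots> = (\<Sum>x\<le>d. \<Sum>b<a. int (a choose b) * ((-1)^(d - x) * int (d choose x) * int x ^ b))"
  proof (rule sum.cong, simp)
    fix x
    have "int (Suc x) ^ a = (\<Sum>b\<le>a. int (a choose b) * int x ^ b)"
      using binomial_ring[of "int x" 1 a] by (simp add: add.commute)
    then have "int (Suc x) ^ a - int x ^ a = (\<Sum>b<a. int (a choose b) * int x ^ b)"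
      by (simp add: lessThan_Suc_atMost[symmetric])
    then show "(-1)^(d - x) * int (d choose x) * (int (Suc x) ^ a - int x ^ a) =
      (\<Sum>b<a. int (a choose b) * ((-1)^(d - x) * int (d choose x) * int x ^ b))"
      by (simp add: sum_distrib_left algebra_simps)
  qed
  also have "\<dots> = (\<Sum>b<a. int (a choose b) * (\<Sum>x\<le>d. (-1)^(d - x) * int (d choose x) * int x ^ b))"
    by (subst sum.swap) (simp add: sum_distrib_left)
  also have "\<dots> = 0"
    using Suc by (intro sum.neutral) auto
  finally show ?case .
qed simp

section \<open>Polynomial functions of bounded total degree and their iterated differences\<close>

text \<open>Polynomials are treated as functions spanned by monomials, since only linearity and
  degree matter. The bound is strict so that \<open>D = 0\<close> leaves only the zero function;
  this is what the empty product needs in \<open>degree_below_prod\<close>.\<close>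

inductive degree_below :: "nat \<Rightarrow> nat \<Rightarrow> ((nat \<Rightarrow> nat) \<Rightarrow> int) \<Rightarrow> bool" for n where
  zero: "degree_below n D (\<lambda>t. 0)"
| monomial: "(\<Sum>i<n. \<alpha> i) < D \<Longrightarrow> degree_below n D (\<lambda>t. c * (\<Prod>i<n. int (t i) ^ \<alpha> i))"
| add: "degree_below n D f \<Longrightarrow> degree_below n D g \<Longrightarrow> degree_below n D (\<lambda>t. f t + g t)"

lemma degree_below_scale:
  "degree_below n D f \<Longrightarrow> degree_below n D (\<lambda>t. c * f t)"
proof (induction rule: degree_below.induct)
  case (zero D)
  then show ?case by (simp add: degree_below.zero)
next
  case (monomial \<alpha> D c')
  then show ?case using degree_below.monomial[of \<alpha> n D "c * c'"] by (simp add: mult.assoc)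
next
  case (add D f g)
  then show ?case using degree_below.add by (simp add: distrib_left)
qed

lemma degree_below_var:
  assumes "i < n"
  shows "degree_below n D f \<Longrightarrow> degree_below n (Suc D) (\<lambda>t. int (t i) * f t)"
proof (induction rule: degree_below.induct)
  case (zero D)
  then show ?case by (simp add: degree_below.zero)
next
  case (monomial \<alpha> D c)
  let ?\<beta> = "\<alpha>(i := Suc (\<alpha> i))"
  have sum: "(\<Sum>j<n. ?\<beta> j) = Suc (\<Sum>j<n. \<alpha> j)"
    using assms by (simp add: sum.remove[of "{..<n}" i])
  have eq: "int (t i) * (c * (\<Prod>j<n. int (t j) ^ \<alpha> j)) = c * (\<Prod>j<n. int (t j) ^ ?\<beta> j)" for t
    using assms by (simp add: prod.remove[of "{..<n}" i])
  show ?case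
    unfolding eq by (rule degree_below.monomial) (use sum monomial in linarith)
next
  case (add D f g)
  then show ?case using degree_below.add by (simp add: distrib_left)
qed

lemma degree_below_Suc:
  "degree_below n D f \<Longrightarrow> degree_below n (Suc D) f"
proof (induction rule: degree_below.induct)
  case (monomial \<alpha> D c)
  then show ?case by (intro degree_below.monomial) simp
qed (auto intro: degree_below.intros)

lemma degree_below_linear:
  assumes "i < n" "j < n" "degree_below n D f"
  shows "degree_below n (Suc D) (\<lambda>t. (int (t i) - int (t j)) * f t)"
  using degree_below.add[OF degree_below_var[OF assms(1,3)]
      degree_below_scale[OF degree_below_var[OF assms(2,3)], of "-1"]]
  by (simp add: algebra_simps)

text \<open>Both claims need a common induction: if L is the linear part of the new factor and F, G
  are the two products over \<open>I\<close>, then (L + c) F - L G = L (F - G) + c F, and the last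
  summand is bounded by the first claim.\<close>

lemma degree_below_prod:
  assumes "finite I" "\<forall>l\<in>I. a l < n \<and> b l < n"
  shows "degree_below n (Suc (card I)) (\<lambda>t. \<Prod>l\<in>I. int (t (a l)) - int (t (b l)) + c l)
    \<and> degree_below n (card I) (\<lambda>t. (\<Prod>l\<in>I. int (t (a l)) - int (t (b l)) + c l) - (\<Prod>l\<in>I. int (t (a l)) - int (t (b l))))"
  using assms
proof (induction I rule: finite_induct)
  case empty
  show ?case using degree_below.monomial[of "\<lambda>_. 0" n "Suc 0" 1] by (auto intro: degree_below.zero)
next
  case (insert x I)
  let ?L = "\<lambda>t::nat \<Rightarrow> nat. int (t (a x)) - int (t (b x))"
  let ?F = "\<lambda>t. \<Prod>l\<in>I. int (t (a l)) - int (t (b l)) + c l"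
  let ?G = "\<lambda>t. \<Prod>l\<in>I. int (t (a l)) - int (t (b l))"
  have F: "degree_below n (Suc (card I)) ?F"
    and FG: "degree_below n (card I) (\<lambda>t. ?F t - ?G t)" using insert by auto
  have ab: "a x < n" "b x < n" using insert by auto
  have "degree_below n (Suc (Suc (card I))) (\<lambda>t. ?L t * ?F t + c x * ?F t)"
    by (intro degree_below.add degree_below_linear ab F degree_below_Suc degree_below_scale)
  moreover have "degree_below n (Suc (card I)) (\<lambda>t. ?L t * (?F t - ?G t) + c x * ?F t)"
    by (intro degree_below.add degree_below_linear ab F FG degree_below_scale)
  ultimately show ?case using insert by (simp add: algebra_simps)
qed

text \<open>The d-th forward difference in each of the n variables, evaluated at the origin.\<close>

definition iterated_difference :: "nat \<Rightarrow> nat \<Rightarrow> ((nat \<Rightarrow> nat) \<Rightarrow> int) \<Rightarrow> int" where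
  "iterated_difference n d f =
     (\<Sum>t\<in>PiE {..<n} (\<lambda>_. {..d}). (\<Prod>i<n. (-1)^(d - t i) * int (d choose t i)) * f t)"

text \<open>For a monomial the sum over the grid factors into one-variable sums. Total degree below
  n d forces some exponent below d, and the factor of that variable vanishes.\<close>

lemma iterated_difference_zero:
  "degree_below n D f \<Longrightarrow> D \<le> n * d \<Longrightarrow> iterated_difference n d f = 0"
proof (induction rule: degree_below.induct)
  case (zero D)
  then show ?case by (simp add: iterated_difference_def)
next
  case (monomial \<alpha> D c)
  have "\<exists>i<n. \<alpha> i < d"
  proof (rule ccontr)
    assume "\<not> ?thesis"
    then have "(\<Sum>i<n. d) \<le> (\<Sum>i<n. \<alpha> i)" by (intro sum_mono) auto
    then show False using monomial by simp
  qed
  then obtain i where i: "i < n" "\<alpha> i < d" by auto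
  have "iterated_difference n d (\<lambda>t. c * (\<Prod>i<n. int (t i) ^ \<alpha> i)) =
    c * (\<Sum>t\<in>PiE {..<n} (\<lambda>_. {..d}). \<Prod>i<n. (-1)^(d - t i) * int (d choose t i) * int (t i) ^ \<alpha> i)"
    by (simp add: iterated_difference_def sum_distrib_left prod.distrib mult_ac)
  also have "(\<Sum>t\<in>PiE {..<n} (\<lambda>_. {..d}). \<Prod>i<n. (-1)^(d - t i) * int (d choose t i) * int (t i) ^ \<alpha> i)
    = (\<Prod>i<n. \<Sum>x\<le>d. (-1)^(d - x) * int (d choose x) * int x ^ \<alpha> i)"
    by (rule prod_sum_PiE[symmetric]) auto
  also have "\<dots> = 0"
    using i alternating_sum_power[OF i(2)] by (intro prod_zero) auto
  finally show ?case by simp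
next
  case (add D f g)
  then show ?case by (simp add: iterated_difference_def distrib_left sum.distrib)
qed

lemma iterated_difference_shift:
  assumes "finite I" "\<forall>l\<in>I. a l < n \<and> b l < n" "card I = n * d"
  shows "iterated_difference n d (\<lambda>t. \<Prod>l\<in>I. int (t (a l)) - int (t (b l)) + c l) =
    iterated_difference n d (\<lambda>t. \<Prod>l\<in>I. int (t (a l)) - int (t (b l)))"
proof -
  have "iterated_difference n d (\<lambda>t. (\<Prod>l\<in>I. int (t (a l)) - int (t (b l)) + c l)
      - (\<Prod>l\<in>I. int (t (a l)) - int (t (b l)))) = 0"
    using degree_below_prod[OF assms(1,2), of c] assms(3) by (intro iterated_difference_zero) auto
  then show ?thesis
    by (simp add: iterated_difference_def right_diff_distrib sum_subtractf)
qed

text \<open>The intervals \<open>{t i..<t i + m}\<close> are disjoint and fill \<open>{..<n * m}\<close>, so each of them, except the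
  topmost one, is followed directly by another; by the asymmetric gap condition that one has a smaller index.\<close>

lemma decreasing_spacing_unique:
  fixes t :: "nat \<Rightarrow> nat"
  assumes m: "m > 0" and bound: "\<And>i. i < n \<Longrightarrow> t i \<le> m * (n - 1)"
    and gap: "\<And>i j. i < j \<Longrightarrow> j < n \<Longrightarrow> t j + m \<le> t i \<or> t i + m < t j"
    and i: "i < n"
  shows "t i = m * (n - 1 - i)"
proof -
  have gap': "t j + m \<le> t i \<or> t i + m \<le> t j" if "i < n" "j < n" "i \<noteq> j" for i j
    using gap[of i j] gap[of j i] that by linarith
  have "n > 0" using i by simp
  have tiles: "(\<Union>i<n. {t i..<t i + m}) = {..<n * m}"
  proof (rule card_subset_eq)
    have "t i + m \<le> n * m" if "i < n" for i
    proof -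
      have "t i + m \<le> m * (n - 1) + m" using bound[OF that] by simp
      also have "\<dots> = n * m" using \<open>n > 0\<close> by (cases n) auto
      finally show ?thesis .
    qed
    then show "(\<Union>i<n. {t i..<t i + m}) \<subseteq> {..<n * m}" by fastforce
    have "card (\<Union>i<n. {t i..<t i + m}) = (\<Sum>i<n. card {t i..<t i + m})"
    proof (rule card_UN_disjoint)
      show "\<forall>i\<in>{..<n}. \<forall>j\<in>{..<n}. i \<noteq> j \<longrightarrow> {t i..<t i + m} \<inter> {t j..<t j + m} = {}"
      proof (intro ballI impI)
        fix i j assume "i \<in> {..<n}" "j \<in> {..<n}" "i \<noteq> j"
        then show "{t i..<t i + m} \<inter> {t j..<t j + m} = {}" using gap'[of i j] by auto
      qed
    qed auto
    then show "card (\<Union>i<n. {t i..<t i + m}) = card {..<n * m}" by simp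
  qed simp
  show ?thesis using i
  proof (induction i rule: less_induct)
    case (less i)
    have inj: "t l \<noteq> t i" if "l < i" for l
      using gap'[of l i] that less.prems m by auto
    show ?case
    proof (cases "t i = m * (n - 1)")
      case True
      have "i = 0"
      proof (rule ccontr)
        assume "i \<noteq> 0"
        then show False using less.IH[of 0] inj[of 0] True \<open>n > 0\<close> by auto
      qed
      then show ?thesis using True by simp
    next
      case False
      have "t i + m \<le> m * (n - 1) + m" "m * (n - 1) + m = n * m"
        using bound[OF less.prems] \<open>n > 0\<close> by (simp, cases n, auto)
      with False have "t i + m \<in> {..<n * m}" by simp
      then obtain l where l: "l < n" "t l \<le> t i + m" "t i + m < t l + m"
        unfolding tiles[symmetric] by auto
      then have "l \<noteq> i" by auto
      then have eq: "t l = t i + m" using gap'[of l i] l less.prems by auto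
      then have "l < i" using gap[of i l] \<open>l \<noteq> i\<close> l by (cases "l < i") auto
      have tl: "t l = m * (n - 1 - l)" using less.IH[OF \<open>l < i\<close>] l by simp
      have ti: "t i = m * (n - 1 - Suc l)"
      proof -
        have "n - 1 - l = Suc (n - 1 - Suc l)" using \<open>l < i\<close> less.prems by auto
        then show ?thesis using tl eq by simp
      qed
      \<comment> \<open>If \<open>Suc l < i\<close>, the induction hypothesis says that the interval
        of index \<open>Suc l\<close> already sits at this position.\<close>
      have "i = Suc l"
      proof (rule ccontr)
        assume "i \<noteq> Suc l"
        then have "Suc l < i" using \<open>l < i\<close> by simp
        then show False using less.IH[of "Suc l"] inj[of "Suc l"] ti less.prems by auto
      qed
      then show ?thesis using ti by simp
    qed
  qed
qed

lemma prime_disjoint_translates: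
  fixes F :: "nat \<Rightarrow> int set"
  assumes p: "prime p" and k: "k \<ge> 3" and pk: "p = n * (k * (k - 1)) + 1"
    and F: "\<And>i. i < n \<Longrightarrow> finite (F i) \<and> card (F i) = k"
  shows "\<exists>t :: nat \<Rightarrow> nat. \<forall>i<n. \<forall>j<n. i \<noteq> j \<longrightarrow>
    (\<forall>x\<in>F i. \<forall>y\<in>F j. \<not> int p dvd (x + int (t i)) - (y + int (t j)))"
proof (rule ccontr)
  assume none: "\<not> ?thesis"
  \<comment> \<open>\<open>2 * m\<close> is the least even number that leaves room for the k^2
    differences of a pair of blocks. Being even, it makes the number of factors a multiple n d of n
    with integral d.\<close>
  define m where "m = (k * k + 1) div 2"
  define d where "d = m * (n - 1)"
  have n: "n > 0" using p pk by (cases n) auto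
  have m2: "k * k \<le> 2 * m" "2 * m \<le> k * k + 1" and m: "m > 0"
    using k by (auto simp: m_def)
  \<comment> \<open>By k >= 3, k^2 + 1 <= 2 k (k - 1), so m <= k (k - 1). The bound later keeps both
    the binomial coefficients and the factors of \<open>g t0\<close> prime to p.\<close>
  have mnp: "m * n < p"
  proof -
    have "k * 3 \<le> k * k" using k by simp
    then have "k * k + 1 \<le> 2 * (k * k - k)" using k by linarith
    then have "2 * m \<le> 2 * (k * (k - 1))" using m2 by (simp add: right_diff_distrib')
    then have "m * n \<le> n * (k * (k - 1))" by (subst mult.commute) (intro mult_left_mono, auto)
    then show ?thesis using pk by (metis less_Suc_eq_le Suc_eq_plus1)
  qed
  have dp: "d < p"
    using mnp n unfolding d_def by (cases n) auto
  define I where "I = (SIGMA j:{..<n}. {..<j} \<times> {..<2 * m})"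
  have finI: "finite I" by (simp add: I_def)
  have cardI: "card I = n * d"
  proof -
    have sum: "(\<Sum>j<N. j * (2 * m)) = N * (m * (N - 1))" for N
    proof (induction N)
      case (Suc N)
      then show ?case by (cases N) (simp_all add: algebra_simps)
    qed simp
    have "card I = (\<Sum>j<n. j * (2 * m))" unfolding I_def by (subst card_SigmaI) auto
    also have "\<dots> = n * d"
      unfolding d_def by (rule sum)
    finally show ?thesis .
  qed
  let ?a = "\<lambda>(j, i, s). i" and ?b = "\<lambda>(j, i, s). j"
  have ab: "\<forall>l\<in>I. ?a l < n \<and> ?b l < n" unfolding I_def by auto
  \<comment> \<open>The constants come from inverting an injection of the difference set into the 2
    m indices. Surplus indices only contribute further factors, which cannot destroy divisibility by
    p.\<close>
  have "\<exists>c :: nat \<Rightarrow> int. (\<lambda>(x, y). x - y) ` (F i \<times> F j) \<subseteq> c ` {..<2 * m}" if "i < n" "j < n" for i j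
  proof -
    let ?D = "(\<lambda>(x, y). x - y) ` (F i \<times> F j)"
    have "card ?D \<le> card (F i \<times> F j)" using F that by (intro card_image_le) auto
    also have "\<dots> = k * k" using F that by (simp add: card_cartesian_product)
    finally have "card ?D \<le> card {..<2 * m}" using m2 by simp
    moreover have "finite ?D" using F that by auto
    ultimately obtain g where "inj_on g ?D" "g ` ?D \<subseteq> {..<2 * m}"
      by (metis card_le_inj finite_lessThan)
    then have "?D \<subseteq> (inv_into ?D g) ` {..<2 * m}"
      by (metis image_mono inv_into_image_cancel order_refl)
    then show ?thesis by blast
  qed
  then obtain c :: "nat \<Rightarrow> nat \<Rightarrow> nat \<Rightarrow> int" where
    c: "\<And>i j. i < n \<Longrightarrow> j < n \<Longrightarrow> (\<lambda>(x, y). x - y) ` (F i \<times> F j) \<subseteq> c i j ` {..<2 * m}"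
    by metis
  define f where "f = (\<lambda>t. \<Prod>l\<in>I. int (t (?a l)) - int (t (?b l)) + (\<lambda>(j, i, s). c i j s) l)"
  \<comment> \<open>For a pair i < j some factor vanishes exactly when -m <= t i - t j < m.
    Nonvanishing of \<open>g\<close> is therefore the asymmetric gap condition of
    \<open>decreasing_spacing_unique\<close>.\<close>
  define g where "g = (\<lambda>t. \<Prod>l\<in>I. int (t (?a l)) - int (t (?b l)) + (\<lambda>(j, i, s). int s - int m + 1) l)"
  have fg: "iterated_difference n d f = iterated_difference n d g"
    unfolding f_def g_def iterated_difference_shift[OF finI ab cardI] ..
  have "int p dvd f t" for t
  proof -
    obtain i j x y where ij: "i < n" "j < n" "i \<noteq> j" "x \<in> F i" "y \<in> F j"
      "int p dvd (x + int (t i)) - (y + int (t j))"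
      using none by blast
    have "\<exists>i j x y. i < j \<and> j < n \<and> x \<in> F i \<and> y \<in> F j \<and> int p dvd int (t i) - int (t j) + (x - y)"
    \<comment> \<open>\<open>I\<close> contains only pairs with i < j, so a collision in the other
      order is read with the two blocks exchanged.\<close>
    proof (cases "i < j")
      case True
      then show ?thesis using ij by (force simp: algebra_simps)
    next
      case False
      have "(y + int (t j)) - (x + int (t i)) = - ((x + int (t i)) - (y + int (t j)))" by simp
      then have "int p dvd (y + int (t j)) - (x + int (t i))"
        using ij(6) by (metis dvd_minus_iff)
      then have "int p dvd int (t j) - int (t i) + (y - x)" by (simp add: algebra_simps)
      then show ?thesis using ij False by (metis linorder_neqE_nat)
    qed
    then obtain i j x y where ij: "i < j" "j < n" "x \<in> F i" "y \<in> F j"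
      "int p dvd int (t i) - int (t j) + (x - y)" by blast
    have "x - y \<in> (\<lambda>(x, y). x - y) ` (F i \<times> F j)" using ij by auto
    then obtain s where s: "s < 2 * m" "x - y = c i j s" using c[of i j] ij by auto
    then have "(j, i, s) \<in> I" using ij by (auto simp: I_def)
    then have "int (t i) - int (t j) + c i j s dvd f t"
      unfolding f_def by (rule dvd_prod_eqI[OF finI]) auto
    then show ?thesis using ij s by auto
  qed
  then have "int p dvd iterated_difference n d f"
    unfolding iterated_difference_def by (intro dvd_sum) auto
  with fg have dvd: "int p dvd iterated_difference n d g" by simp
  define t0 where "t0 = (\<lambda>i\<in>{..<n}. m * (n - 1 - i))"
  have g0: "g t = 0" if "t \<in> PiE {..<n} (\<lambda>_. {..d})" "t \<noteq> t0" for t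
  proof (rule ccontr)
    assume nz: "g t \<noteq> 0"
    have fac: "int (t i) - int (t j) + (int s - int m + 1) \<noteq> 0" if "i < j" "j < n" "s < 2 * m" for i j s
    proof -
      have "(j, i, s) \<in> I" using that by (auto simp: I_def)
      then show ?thesis using nz finI unfolding g_def by (auto simp: prod_zero_iff)
    qed
    have "t i = m * (n - 1 - i)" if "i < n" for i
    proof (rule decreasing_spacing_unique[OF m _ _ that])
      show "t i \<le> m * (n - 1)" if "i < n" for i
        using \<open>t \<in> _\<close> that by (auto simp: d_def dest: PiE_mem)
      show "t j + m \<le> t i \<or> t i + m < t j" if "i < j" "j < n" for i j
      proof (rule ccontr)
        assume *: "\<not> ?thesis"
        then have "int (t i) - int (t j) + (int (t j + m - 1 - t i) - int m + 1) = 0"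
          by (auto simp: of_nat_diff)
        moreover have "t j + m - 1 - t i < 2 * m" using * m by auto
        ultimately show False using fac[OF that] by blast
      qed
    qed
    then have "t = t0" using that(1) by (auto simp: t0_def PiE_def extensional_def restrict_def)
    with that show False by simp
  qed
  have t0: "t0 \<in> PiE {..<n} (\<lambda>_. {..d})" by (auto simp: t0_def d_def)
  have "iterated_difference n d g =
      (\<Sum>t\<in>{t0}. (\<Prod>i<n. (-1)^(d - t i) * int (d choose t i)) * g t)"
    unfolding iterated_difference_def
    using t0 g0 by (intro sum.mono_neutral_right) (auto intro: finite_PiE)
  then have "int p dvd (\<Prod>i<n. (-1)^(d - t0 i) * int (d choose t0 i)) * g t0"
    using dvd by simp
  moreover have pi: "prime (int p)" using p by simp
  ultimately have "int p dvd (\<Prod>i<n. (-1)^(d - t0 i) * int (d choose t0 i)) \<or> int p dvd g t0"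
    by (simp add: prime_dvd_mult_iff)
  moreover have "\<not> int p dvd (\<Prod>i<n. (-1)^(d - t0 i) * int (d choose t0 i))"
  proof
    assume "int p dvd (\<Prod>i<n. (-1)^(d - t0 i) * int (d choose t0 i))"
    then obtain i where i: "i < n" "int p dvd (-1)^(d - t0 i) * int (d choose t0 i)"
      using pi by (auto simp: prime_dvd_prod_iff)
    then have "int p dvd (-1)^(d - t0 i) \<or> int p dvd int (d choose t0 i)"
      using pi by (simp add: prime_dvd_mult_iff)
    moreover have "\<not> int p dvd (-1)^(d - t0 i)"
      using pi by (metis not_prime_unit dvd_trans is_unit_power_iff minus_dvd_iff one_dvd dvd_refl is_unitE prime_dvd_power)
    ultimately have "p dvd (d choose t0 i)" by simp
    moreover have "(d choose t0 i) dvd fact d"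
      using t0 i binomial_fact_lemma[of "t0 i" d] by (auto dest!: PiE_mem) (metis dvd_triv_right)
    ultimately have "p dvd fact d" by (rule dvd_trans)
    then show False using p dp by (simp add: prime_dvd_fact_iff)
  qed
  moreover have "\<not> int p dvd g t0"
  proof
    assume "int p dvd g t0"
    then obtain j i s where l: "j < n" "i < j" "s < 2 * m"
      and d: "int p dvd int (t0 i) - int (t0 j) + (int s - int m + 1)"
      using pi finI unfolding g_def I_def by (auto simp: prime_dvd_prod_iff)
    \<comment> \<open>Hence every factor at \<open>t0\<close> lies between m - m + 1 = 1 and m (n -
      1) + m < p.\<close>
    have "int (t0 i) - int (t0 j) = int m * (int j - int i)"
    proof -
      have eq: "int (t0 i) = int m * (int n - 1 - int i)" if "i < n" for i
        using that by (simp add: t0_def of_nat_diff)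
      show ?thesis using eq[of i] eq[of j] l by (simp add: algebra_simps)
    qed
    moreover have "int m * 1 \<le> int m * (int j - int i)" using l m by (intro mult_left_mono) auto
    moreover have "int m * (int j - int i) \<le> int m * (int n - 1)" using l by (intro mult_left_mono) auto
    moreover have "int m * int n < int p" using mnp by (metis of_nat_less_iff of_nat_mult)
    ultimately have "0 < int (t0 i) - int (t0 j) + (int s - int m + 1)"
      "int (t0 i) - int (t0 j) + (int s - int m + 1) < int p"
      using l by (auto simp: algebra_simps)
    then show False using d zdvd_not_zless by blast
  qed
  ultimately show False by blast
qed

section \<open>Almost perfect matchings in almost regular hypergraphs\<close>

text \<open>Here \<open>q\<close> is the probability that a given element is left out of the random subset \<open>A\<close>.\<close>

definition expect :: "real \<Rightarrow> 'e set \<Rightarrow> ('e set \<Rightarrow> real) \<Rightarrow> real" where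
  "expect q E f = (\<Sum>A\<in>Pow E. (1 - q) ^ card A * q ^ card (E - A) * f A)"

text \<open>The weight of \<open>A\<close> is a product over the elements of \<open>E\<close>, so
  the sum over all \<open>A\<close> is the expansion of a product of two-term factors. All
  probabilities below reduce to this one.\<close>

lemma expect_avoids:
  assumes "finite E" "X \<subseteq> E"
  shows "expect q E (\<lambda>A. of_bool (A \<inter> X = {})) = q ^ card X"
proof -
  have "expect q E (\<lambda>A. of_bool (A \<inter> X = {})) =
    (\<Sum>A\<in>Pow E. (\<Prod>e\<in>A. if e \<in> X then 0 else 1 - q) * (\<Prod>e\<in>E - A. q))"
    unfolding expect_def
  proof (rule sum.cong[OF refl])
    fix A assume A: "A \<in> Pow E"
    then have finA: "finite A" using assms finite_subset by auto
    show "(1 - q) ^ card A * q ^ card (E - A) * of_bool (A \<inter> X = {}) =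
      (\<Prod>e\<in>A. if e \<in> X then 0 else 1 - q) * (\<Prod>e\<in>E - A. q)"
    proof (cases "A \<inter> X = {}")
      case True
      then have "(\<Prod>e\<in>A. if e \<in> X then 0 else 1 - q) = (\<Prod>e\<in>A. 1 - q)"
        by (intro prod.cong) auto
      then show ?thesis using True by simp
    next
      case False
      then have "(\<Prod>e\<in>A. if e \<in> X then 0 else 1 - q) = 0"
        using finA by (intro prod_zero) auto
      then show ?thesis using False by simp
    qed
  qed
  also have "\<dots> = (\<Prod>e\<in>E. (if e \<in> X then 0 else 1 - q) + q)"
    using assms by (simp add: prod_add)
  also have "\<dots> = (\<Prod>e\<in>E. if e \<in> X then q else 1)"
    by (intro prod.cong) auto
  also have "\<dots> = q ^ card X"
    using assms by (simp add: prod.If_cases Int_absorb1)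
  finally show ?thesis .
qed

lemma expect_const: "finite E \<Longrightarrow> expect q E (\<lambda>A. c) = c"
  using expect_avoids[of E "{}" q] by (simp add: expect_def sum_distrib_right[symmetric])

lemma expect_add: "expect q E (\<lambda>A. f A + g A) = expect q E f + expect q E g"
  by (simp add: expect_def distrib_left sum.distrib)

lemma expect_diff: "expect q E (\<lambda>A. f A - g A) = expect q E f - expect q E g"
  by (simp add: expect_def right_diff_distrib sum_subtractf)

lemma expect_scale: "expect q E (\<lambda>A. c * f A) = c * expect q E f"
  by (simp add: expect_def sum_distrib_left mult_ac)

lemma expect_sum: "expect q E (\<lambda>A. \<Sum>i\<in>I. f i A) = (\<Sum>i\<in>I. expect q E (f i))"
  unfolding expect_def by (subst sum.swap) (simp add: sum_distrib_left)

lemma expect_mono: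
  assumes "0 \<le> q" "q \<le> 1" "\<And>A. A \<subseteq> E \<Longrightarrow> f A \<le> g A"
  shows "expect q E f \<le> expect q E g"
  unfolding expect_def using assms by (intro sum_mono mult_left_mono) auto

text \<open>The first moment method. With 0 < q < 1 all weights are positive, so a strict inequality
  at every \<open>A\<close> would pass to the mean.\<close>

lemma expect_attained:
  assumes "finite E" "0 < q" "q < 1"
  shows "\<exists>A\<subseteq>E. f A \<le> expect q E f"
proof (rule ccontr)
  obtain c where c: "expect q E f = c" by simp
  assume "\<not> ?thesis"
  then have less: "\<forall>A\<subseteq>E. c < f A" unfolding c by (simp add: not_le)
  have "(\<Sum>A\<in>Pow E. (1 - q) ^ card A * q ^ card (E - A) * c) < (\<Sum>A\<in>Pow E. (1 - q) ^ card A * q ^ card (E - A) * f A)"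
  proof (rule sum_strict_mono)
    fix A assume "A \<in> Pow E"
    then have "c < f A" using less by simp
    then show "(1 - q) ^ card A * q ^ card (E - A) * c < (1 - q) ^ card A * q ^ card (E - A) * f A"
      using assms by (intro mult_strict_left_mono) simp_all
  qed (use assms in auto)
  then have "expect q E (\<lambda>A. c) < c" unfolding c[symmetric] by (simp only: expect_def)
  then show False using expect_const[OF assms(1), of q c] by linarith
qed

text \<open>Inclusion-exclusion over the two elements being avoided: 1 - 2 q + q^2.\<close>

lemma expect_two:
  assumes "finite E" "e \<in> E" "f \<in> E" "e \<noteq> f"
  shows "expect q E (\<lambda>A. of_bool (e \<in> A \<and> f \<in> A)) = (1 - q)\<^sup>2"
proof -
  have "(\<lambda>A. of_bool (e \<in> A \<and> f \<in> A) :: real) = (\<lambda>A. 1 - of_bool (A \<inter> {e} = {})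
    - of_bool (A \<inter> {f} = {}) + of_bool (A \<inter> {e, f} = {}))"
    by auto
  then have "expect q E (\<lambda>A. of_bool (e \<in> A \<and> f \<in> A)) = expect q E (\<lambda>A. 1 - of_bool (A \<inter> {e} = {})
    - of_bool (A \<inter> {f} = {}) + of_bool (A \<inter> {e, f} = {}))"
    by (rule arg_cong)
  also have "\<dots> = 1 - q ^ card {e} - q ^ card {f} + q ^ card {e, f}"
    using assms unfolding expect_add expect_diff expect_const[OF assms(1)]
    by (subst (1 2 3) expect_avoids) auto
  also have "\<dots> = (1 - q)\<^sup>2"
    using assms(4) by (simp add: power2_eq_square algebra_simps)
  finally show ?thesis .
qed

text \<open>Survival probabilities are exponentials of edge counts; this converts errors in the
  counts into errors in the probabilities.\<close>

lemma exp_minus_lipschitz: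
  fixes x y :: real
  assumes "0 \<le> x" "0 \<le> y"
  shows "\<bar>exp (- x) - exp (- y)\<bar> \<le> \<bar>x - y\<bar>"
proof -
  have *: "exp (- a) - exp (- b) \<le> b - a" if "0 \<le> a" "a \<le> b" for a b :: real
  proof -
    have "exp (- a) - exp (- b) = exp (- a) * (1 - exp (- (b - a)))"
      by (simp add: right_diff_distrib exp_add[symmetric])
    also have "\<dots> \<le> 1 * (b - a)"
    proof (rule mult_mono)
      show "1 - exp (- (b - a)) \<le> b - a" using exp_ge_add_one_self[of "- (b - a)"] by linarith
    qed (use that in auto)
    finally show ?thesis by simp
  qed
  show ?thesis using *[of x y] *[of y x] assms by (cases "x \<le> y") auto
qed

section \<open>One random round in an almost regular hypergraph\<close>

definition degree_in :: "'a set set \<Rightarrow> 'a \<Rightarrow> nat" where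
  "degree_in E x = card {e \<in> E. x \<in> e}"

definition incident :: "'a set set \<Rightarrow> 'a set \<Rightarrow> 'a set set" where
  "incident E Y = {e \<in> E. e \<inter> Y \<noteq> {}}"

text \<open>The waste of a round: chosen edges that meet another chosen edge are discarded, yet the
  next round works outside all of \<open>\<Union>A\<close>.\<close>

definition collided :: "'a set set \<Rightarrow> 'a set" where
  "collided A = {x. \<exists>e\<in>A. x \<in> e \<and> (\<exists>f\<in>A. f \<noteq> e \<and> e \<inter> f \<noteq> {})}"

text \<open>\<open>D\<close> is the nominal degree and shrinks from round to round, while
  \<open>D0\<close> bounds the degrees in all rounds and stays fixed. Closeness to \<open>D\<close>
  is not demanded at each vertex. It is only measured through the sum of \<open>dev\<close>, so no
  exceptional vertices ever have to be removed.\<close>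

locale hypergraph =
  fixes W :: "'a set" and E :: "'a set set" and r K :: nat and D D0 \<epsilon> :: real
  assumes finW: "finite W"
    and edge: "\<And>e. e \<in> E \<Longrightarrow> e \<subseteq> W \<and> card e = r"
    and degree_le: "\<And>x. x \<in> W \<Longrightarrow> real (degree_in E x) \<le> D0"
    and codegree: "\<And>x y. x \<in> W \<Longrightarrow> y \<in> W \<Longrightarrow> x \<noteq> y \<Longrightarrow> card {e \<in> E. x \<in> e \<and> y \<in> e} \<le> K"
    and D: "0 < D" and eps: "0 < \<epsilon>"
begin

text \<open>With this choice a vertex of degree exactly \<open>D\<close> stays uncovered with probability \<open>exp (- \<epsilon>)\<close>.\<close>

definition q where "q = exp (- (\<epsilon> / D))"
definition dev where "dev y = \<bar>real (degree_in E y) - D\<bar>"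

lemma q: "0 < q" "q < 1" "1 - q \<le> \<epsilon> / D"
  using D eps exp_ge_add_one_self[of "- (\<epsilon> / D)"] by (auto simp: q_def)

lemma dev_nonneg: "0 \<le> dev y" by (simp add: dev_def)

lemma finE: "finite E"
  by (rule finite_subset[of _ "Pow W"]) (use edge finW in auto)

lemma finite_edge: "e \<in> E \<Longrightarrow> finite e"
  using edge finW finite_subset by blast

text \<open>Vertices are added one at a time. A new one contributes its degree minus the edges
  shared with earlier ones, at most K for each of them; the overlaps total at most K |Y|^2.\<close>

lemma incident_card:
  assumes "Y \<subseteq> W"
  shows "\<bar>real (card (incident E Y)) - D * card Y\<bar> \<le> (\<Sum>y\<in>Y. dev y) + K * (real (card Y))\<^sup>2"
  using finite_subset[OF assms finW] assms
proof (induction Y rule: finite_induct)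
  case empty
  then show ?case by (simp add: incident_def)
next
  case (insert y Y)
  let ?Ey = "{e \<in> E. y \<in> e}"
  have fin: "finite (incident E Y)" "finite ?Ey" using finE by (auto simp: incident_def)
  have "incident E (insert y Y) = incident E Y \<union> ?Ey" by (auto simp: incident_def)
  then have card: "card (incident E (insert y Y)) + card (incident E Y \<inter> ?Ey) = card (incident E Y) + degree_in E y"
    unfolding degree_in_def using card_Un_Int[OF fin] by simp
  have "incident E Y \<inter> ?Ey \<subseteq> (\<Union>z\<in>Y. {e \<in> E. z \<in> e \<and> y \<in> e})" by (auto simp: incident_def)
  then have "card (incident E Y \<inter> ?Ey) \<le> card (\<Union>z\<in>Y. {e \<in> E. z \<in> e \<and> y \<in> e})"
    using insert finE by (intro card_mono) auto
  also have "\<dots> \<le> (\<Sum>z\<in>Y. card {e \<in> E. z \<in> e \<and> y \<in> e})" using insert by (intro card_UN_le) auto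
  also have "\<dots> \<le> (\<Sum>z\<in>Y. K)" using insert by (intro sum_mono codegree) auto
  finally have "card (incident E Y \<inter> ?Ey) \<le> K * card Y" by (simp add: mult.commute)
  then have int: "real (card (incident E Y \<inter> ?Ey)) \<le> K * card Y"
    by (metis of_nat_le_iff of_nat_mult)
  have "real (card (incident E (insert y Y))) - D * card (insert y Y)
    = (real (card (incident E Y)) - D * card Y) + (real (degree_in E y) - D) - card (incident E Y \<inter> ?Ey)"
    using card insert by (simp add: algebra_simps)
  also have "\<bar>\<dots>\<bar> \<le> ((\<Sum>y\<in>Y. dev y) + K * (real (card Y))\<^sup>2) + dev y + K * card Y"
    using int insert unfolding dev_def by (auto simp: abs_le_iff)
  also have "\<dots> \<le> (\<Sum>y\<in>insert y Y. dev y) + K * (real (card (insert y Y)))\<^sup>2"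
    using insert by (simp add: power2_eq_square algebra_simps)
  finally show ?case .
qed

definition survive where "survive Y = expect q E (\<lambda>A. of_bool (Y \<inter> \<Union>A = {}))"

lemma survive_eq: "survive Y = q ^ card (incident E Y)"
proof -
  have "survive Y = expect q E (\<lambda>A. of_bool (A \<inter> incident E Y = {}))"
    unfolding survive_def expect_def by (intro sum.cong) (auto simp: incident_def)
  also have "\<dots> = q ^ card (incident E Y)"
    by (rule expect_avoids[OF finE]) (auto simp: incident_def)
  finally show ?thesis .
qed

lemma survive_approx:
  assumes "Y \<subseteq> W"
  shows "\<bar>survive Y - exp (- \<epsilon>) ^ card Y\<bar> \<le> \<epsilon> / D * ((\<Sum>y\<in>Y. dev y) + K * (real (card Y))\<^sup>2)"
proof -
  have "\<bar>survive Y - exp (- \<epsilon>) ^ card Y\<bar> = \<bar>exp (- (\<epsilon> / D * card (incident E Y))) - exp (- (\<epsilon> * card Y))\<bar>"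
    by (simp add: survive_eq q_def exp_of_nat_mult[symmetric] mult.commute)
  also have "\<dots> \<le> \<bar>\<epsilon> / D * card (incident E Y) - \<epsilon> * card Y\<bar>"
    using D eps by (intro exp_minus_lipschitz) auto
  also have "\<dots> = \<epsilon> / D * \<bar>real (card (incident E Y)) - D * card Y\<bar>"
  proof -
    have "\<epsilon> / D * card (incident E Y) - \<epsilon> * card Y = \<epsilon> / D * (real (card (incident E Y)) - D * card Y)"
      using D by (simp add: field_simps)
    then show ?thesis using D eps by (simp only: abs_mult) simp
  qed
  also have "\<dots> \<le> \<epsilon> / D * ((\<Sum>y\<in>Y. dev y) + K * (real (card Y))\<^sup>2)"
    using D eps by (intro mult_left_mono incident_card assms) auto
  finally show ?thesis .
qed

lemma expect_left:
  "expect q E (\<lambda>A. card (W - \<Union>A)) \<le> exp (- \<epsilon>) * card W + \<epsilon> / D * ((\<Sum>y\<in>W. dev y) + K * card W)"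
proof -
  have "real (card (W - \<Union>A)) = (\<Sum>x\<in>W. of_bool ({x} \<inter> \<Union>A = {}))" for A
  proof -
    have "(\<Sum>x\<in>W. of_bool ({x} \<inter> \<Union>A = {})) = (\<Sum>x\<in>W. if x \<notin> \<Union>A then 1 else 0 :: real)"
      by (intro sum.cong) auto
    also have "\<dots> = real (card (W \<inter> {x. x \<notin> \<Union>A}))"
      using finW by (simp only: sum.If_cases) simp
    also have "W \<inter> {x. x \<notin> \<Union>A} = W - \<Union>A" by auto
    finally show ?thesis ..
  qed
  then have "expect q E (\<lambda>A. card (W - \<Union>A)) = (\<Sum>x\<in>W. survive {x})"
    by (simp only: expect_sum survive_def)
  also have "\<dots> \<le> (\<Sum>x\<in>W. exp (- \<epsilon>) + \<epsilon> / D * (dev x + K))"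
  proof (rule sum_mono)
    fix x assume "x \<in> W"
    then show "survive {x} \<le> exp (- \<epsilon>) + \<epsilon> / D * (dev x + K)"
      using survive_approx[of "{x}"] by (auto simp: abs_le_iff)
  qed
  also have "\<dots> = exp (- \<epsilon>) * card W + \<epsilon> / D * ((\<Sum>y\<in>W. dev y) + K * card W)"
    by (simp add: sum.distrib sum_distrib_left sum_divide_distrib algebra_simps)
  finally show ?thesis .
qed

text \<open>At most D0^2 |W| ordered pairs of edges meet, both members are chosen with probability
  (1 - q)^2, and a pair wastes at most r vertices. The waste is thus quadratic in \<epsilon>,
  whereas the number of rounds needed is only of order 1/\<epsilon>: many small rounds waste little
  in total.\<close>

lemma expect_collided:
  "expect q E (\<lambda>A. card (collided A)) \<le> r * (\<epsilon> / D)\<^sup>2 * (D0\<^sup>2 * card W)"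
proof -
  define P where "P = {(e, f) \<in> E \<times> E. e \<noteq> f \<and> e \<inter> f \<noteq> {}}"
  have finP: "finite P" unfolding P_def using finE by (auto intro: finite_subset[of _ "E \<times> E"])
  have cardP: "real (card P) \<le> D0\<^sup>2 * card W"
  proof -
    have "P \<subseteq> (\<Union>x\<in>W. {e \<in> E. x \<in> e} \<times> {e \<in> E. x \<in> e})"
      unfolding P_def using edge by fast
    then have "card P \<le> card (\<Union>x\<in>W. {e \<in> E. x \<in> e} \<times> {e \<in> E. x \<in> e})"
      using finW finE by (intro card_mono) auto
    also have "\<dots> \<le> (\<Sum>x\<in>W. degree_in E x * degree_in E x)"
      using card_UN_le[OF finW, of "\<lambda>x. {e \<in> E. x \<in> e} \<times> {e \<in> E. x \<in> e}"]
      by (simp add: card_cartesian_product degree_in_def)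
    finally have "real (card P) \<le> (\<Sum>x\<in>W. real (degree_in E x) * degree_in E x)"
      by (metis (no_types, lifting) of_nat_le_iff of_nat_mult of_nat_sum sum.cong)
    also have "\<dots> \<le> (\<Sum>x\<in>W. D0 * D0)"
    proof (rule sum_mono)
      fix x assume "x \<in> W"
      then show "real (degree_in E x) * degree_in E x \<le> D0 * D0"
        using degree_le[of x] by (intro mult_mono) auto
    qed
    finally show ?thesis by (simp add: power2_eq_square mult.commute)
  qed
  have "expect q E (\<lambda>A. card (collided A)) \<le> expect q E (\<lambda>A. \<Sum>(e, f)\<in>P. real r * of_bool (e \<in> A \<and> f \<in> A))"
  proof (rule expect_mono)
    fix A assume A: "A \<subseteq> E"
    let ?Q = "{z \<in> P. fst z \<in> A \<and> snd z \<in> A}"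
    have finQ: "finite ?Q" using finP by simp
    have "collided A \<subseteq> (\<Union>z\<in>?Q. fst z)" unfolding collided_def P_def using A by fastforce
    moreover have "finite (\<Union>z\<in>?Q. fst z)"
      using finQ finite_edge unfolding P_def by auto
    ultimately have "card (collided A) \<le> card (\<Union>z\<in>?Q. fst z)" by (rule card_mono[rotated])
    also have "\<dots> \<le> (\<Sum>z\<in>?Q. card (fst z))" by (rule card_UN_le[OF finQ])
    also have "\<dots> = (\<Sum>z\<in>?Q. r)" using edge by (intro sum.cong) (auto simp: P_def)
    finally have "real (card (collided A)) \<le> real (\<Sum>z\<in>?Q. r)" by (simp only: of_nat_le_iff)
    also have "\<dots> = (\<Sum>z\<in>?Q. real r)" by simp
    also have "\<dots> = (\<Sum>z\<in>P. if fst z \<in> A \<and> snd z \<in> A then real r else 0)"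
      by (rule sum.inter_filter[OF finP])
    also have "\<dots> = (\<Sum>(e, f)\<in>P. real r * of_bool (e \<in> A \<and> f \<in> A))"
      by (intro sum.cong) auto
    finally show "real (card (collided A)) \<le> (\<Sum>(e, f)\<in>P. real r * of_bool (e \<in> A \<and> f \<in> A))" .
  qed (use q in auto)
  also have "\<dots> = (\<Sum>(e, f)\<in>P. r * expect q E (\<lambda>A. of_bool (e \<in> A \<and> f \<in> A)))"
    by (simp only: expect_sum expect_scale case_prod_unfold)
  also have "\<dots> = (\<Sum>(e, f)\<in>P. r * (1 - q)\<^sup>2)"
  proof (rule sum.cong[OF refl], clarify)
    fix e f assume "(e, f) \<in> P"
    then have "e \<in> E" "f \<in> E" "e \<noteq> f" by (auto simp: P_def)
    then show "real r * expect q E (\<lambda>A. of_bool (e \<in> A \<and> f \<in> A)) = real r * (1 - q)\<^sup>2"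
      using expect_two[OF finE, of e f q] by simp
  qed
  also have "\<dots> = r * (1 - q)\<^sup>2 * card P" by simp
  also have "\<dots> \<le> r * (\<epsilon> / D)\<^sup>2 * (D0\<^sup>2 * card W)"
    using q cardP by (intro mult_mono power_mono) auto
  finally show ?thesis .
qed

text \<open>Leaving out \<open>x\<close> itself avoids conditioning on the survival of
  \<open>x\<close>; for a surviving \<open>x\<close> the value is its new degree
  (\<open>left_degree\<close>).\<close>

definition open_edges where
  "open_edges x A = card {e \<in> E. x \<in> e \<and> (e - {x}) \<inter> \<Union>A = {}}"

lemma edge_minus: "e \<in> E \<Longrightarrow> x \<in> e \<Longrightarrow> card (e - {x}) = r - 1"
  using edge finite_edge by simp

text \<open>These pairs are too dependent for the variance estimate. The codegree bound makes their
  number linear in the degree, where all pairs would be quadratic.\<close>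

lemma intersecting_pairs:
  assumes "x \<in> W"
  shows "card {(e, f). e \<in> E \<and> f \<in> E \<and> x \<in> e \<and> x \<in> f \<and> (e - {x}) \<inter> f \<noteq> {}} \<le> degree_in E x * (r * K)"
proof -
  let ?Ex = "{e \<in> E. x \<in> e}"
  have "{(e, f). e \<in> E \<and> f \<in> E \<and> x \<in> e \<and> x \<in> f \<and> (e - {x}) \<inter> f \<noteq> {}}
    = (SIGMA e:?Ex. {f \<in> E. x \<in> f \<and> (e - {x}) \<inter> f \<noteq> {}})" by auto
  also have "card \<dots> = (\<Sum>e\<in>?Ex. card {f \<in> E. x \<in> f \<and> (e - {x}) \<inter> f \<noteq> {}})"
    using finE by (subst card_SigmaI) auto
  also have "\<dots> \<le> (\<Sum>e\<in>?Ex. r * K)"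
  proof (rule sum_mono)
    fix e assume e: "e \<in> ?Ex"
    have "{f \<in> E. x \<in> f \<and> (e - {x}) \<inter> f \<noteq> {}} \<subseteq> (\<Union>y\<in>e - {x}. {f \<in> E. x \<in> f \<and> y \<in> f})" by auto
    then have "card {f \<in> E. x \<in> f \<and> (e - {x}) \<inter> f \<noteq> {}} \<le> card (\<Union>y\<in>e - {x}. {f \<in> E. x \<in> f \<and> y \<in> f})"
      using finE finite_edge e by (intro card_mono) auto
    also have "\<dots> \<le> (\<Sum>y\<in>e - {x}. card {f \<in> E. x \<in> f \<and> y \<in> f})"
      using finite_edge e by (intro card_UN_le) auto
    also have "\<dots> \<le> (\<Sum>y\<in>e - {x}. K)"
      using edge e assms by (intro sum_mono codegree) auto
    also have "\<dots> \<le> r * K" using edge_minus[of e x] e by simp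
    finally show "card {f \<in> E. x \<in> f \<and> (e - {x}) \<inter> f \<noteq> {}} \<le> r * K" .
  qed
  finally show ?thesis by (simp add: degree_in_def)
qed

text \<open>A second moment centred at the nominal value \<open>d * U\<close>, so that the error of
  the mean is included. If e and f share only x, then e \<union> f - {x} has 2 (r - 1) vertices and
  survives with probability close to U^2, so the corresponding term nearly cancels. Every other pair
  contributes at most 1.\<close>

lemma expect_open_edges:
  fixes U d :: real
  assumes x: "x \<in> W"
  defines "U \<equiv> exp (- \<epsilon>) ^ (r - 1)" and "d \<equiv> real (degree_in E x)"
  shows "expect q E (\<lambda>A. (real (open_edges x A) - d * U)\<^sup>2)
    \<le> \<epsilon> / D * (4 * d * (\<Sum>e\<in>{e \<in> E. x \<in> e}. \<Sum>y\<in>e. dev y) + 6 * (real r)\<^sup>2 * K * d\<^sup>2) + d * r * K"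
proof -
  let ?Ex = "{e \<in> E. x \<in> e}"
  have finEx: "finite ?Ex" using finE by simp
  define g where "g e = (\<Sum>y\<in>e. dev y)" for e
  define X where "X e A = (of_bool ((e - {x}) \<inter> \<Union>A = {}) :: real)" for e A
  define I where "I = {(e, f). e \<in> E \<and> f \<in> E \<and> x \<in> e \<and> x \<in> f \<and> (e - {x}) \<inter> f \<noteq> {}}"
  have U: "0 \<le> U" "U \<le> 1" unfolding U_def using eps by (auto intro: power_le_one)
  have g: "0 \<le> g e" for e unfolding g_def by (intro sum_nonneg dev_nonneg)
  have ed: "0 \<le> \<epsilon> / D" using eps D by simp
  have open_eq: "real (open_edges x A) = (\<Sum>e\<in>?Ex. X e A)" for A
  proof -
    have "(\<Sum>e\<in>?Ex. X e A) = (\<Sum>e\<in>?Ex. if (e - {x}) \<inter> \<Union>A = {} then 1 else 0)"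
      unfolding X_def by (intro sum.cong) auto
    also have "\<dots> = real (card (?Ex \<inter> {e. (e - {x}) \<inter> \<Union>A = {}}))"
      using finEx by (simp only: sum.If_cases) simp
    also have "?Ex \<inter> {e. (e - {x}) \<inter> \<Union>A = {}} = {e \<in> E. x \<in> e \<and> (e - {x}) \<inter> \<Union>A = {}}" by auto
    finally show ?thesis unfolding open_edges_def ..
  qed
  have sq: "(real (open_edges x A) - d * U)\<^sup>2 = (\<Sum>e\<in>?Ex. \<Sum>f\<in>?Ex. (X e A - U) * (X f A - U))" for A
  proof -
    have "real (open_edges x A) - d * U = (\<Sum>e\<in>?Ex. X e A - U)"
      by (simp add: open_eq sum_subtractf d_def degree_in_def)
    then show ?thesis by (simp only: power2_eq_square sum_product)
  qed
  have XX: "X e A * X f A = of_bool ((e \<union> f - {x}) \<inter> \<Union>A = {})" for e f A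
    unfolding X_def by auto
  have pair: "expect q E (\<lambda>A. (X e A - U) * (X f A - U))
      \<le> \<epsilon> / D * (2 * g e + 2 * g f + 6 * (real r)\<^sup>2 * K) + of_bool ((e, f) \<in> I)"
    if e: "e \<in> ?Ex" and f: "f \<in> ?Ex" for e f
  proof (cases "(e, f) \<in> I")
    case True
    have "expect q E (\<lambda>A. (X e A - U) * (X f A - U)) \<le> expect q E (\<lambda>A. 1)"
    proof (rule expect_mono)
      fix A
      have "\<bar>X e A - U\<bar> \<le> 1" "\<bar>X f A - U\<bar> \<le> 1" using U unfolding X_def by auto
      then have "\<bar>(X e A - U) * (X f A - U)\<bar> \<le> 1 * 1" unfolding abs_mult by (intro mult_mono) auto
      then show "(X e A - U) * (X f A - U) \<le> 1" by simp
    qed (use q in auto)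
    moreover have "0 \<le> \<epsilon> / D * (2 * g e + 2 * g f + 6 * (real r)\<^sup>2 * K)"
      using ed g by (intro mult_nonneg_nonneg add_nonneg_nonneg) auto
    ultimately show ?thesis using True expect_const[OF finE] by simp
  next
    case False
    then have disj: "(e - {x}) \<inter> (f - {x}) = {}" using e f unfolding I_def by auto
    have fin: "finite e" "finite f" using e f finite_edge by auto
    have sub: "e \<subseteq> W" "f \<subseteq> W" using e f edge by auto
    have un: "e \<union> f - {x} = (e - {x}) \<union> (f - {x})" by auto
    have cards: "card (e - {x}) = r - 1" "card (f - {x}) = r - 1" "card (e \<union> f - {x}) = (r - 1) + (r - 1)"
      unfolding un using e f edge_minus disj fin by (auto simp: card_Un_disjoint)
    have dev_le: "(\<Sum>y\<in>e - {x}. dev y) \<le> g e" "(\<Sum>y\<in>f - {x}. dev y) \<le> g f"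
      unfolding g_def using fin dev_nonneg by (auto intro!: sum_mono2)
    have dev_un: "(\<Sum>y\<in>e \<union> f - {x}. dev y) \<le> g e + g f"
      unfolding un using fin disj dev_le by (subst sum.union_disjoint) auto
    have Pe: "\<bar>survive (e - {x}) - U\<bar> \<le> \<epsilon> / D * (g e + K * (real r)\<^sup>2)"
    proof -
      have "\<bar>survive (e - {x}) - U\<bar> \<le> \<epsilon> / D * ((\<Sum>y\<in>e - {x}. dev y) + K * (real (r - 1))\<^sup>2)"
        using survive_approx[of "e - {x}"] sub unfolding cards U_def by auto
      also have "\<dots> \<le> \<epsilon> / D * (g e + K * (real r)\<^sup>2)"
        using ed dev_le by (intro mult_left_mono add_mono power_mono) auto
      finally show ?thesis .
    qed
    have Pf: "\<bar>survive (f - {x}) - U\<bar> \<le> \<epsilon> / D * (g f + K * (real r)\<^sup>2)"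
    proof -
      have "\<bar>survive (f - {x}) - U\<bar> \<le> \<epsilon> / D * ((\<Sum>y\<in>f - {x}. dev y) + K * (real (r - 1))\<^sup>2)"
        using survive_approx[of "f - {x}"] sub unfolding cards U_def by auto
      also have "\<dots> \<le> \<epsilon> / D * (g f + K * (real r)\<^sup>2)"
        using ed dev_le by (intro mult_left_mono add_mono power_mono) auto
      finally show ?thesis .
    qed
    have Pef: "\<bar>survive (e \<union> f - {x}) - U * U\<bar> \<le> \<epsilon> / D * (g e + g f + K * (4 * (real r)\<^sup>2))"
    proof -
      have "\<bar>survive (e \<union> f - {x}) - U * U\<bar> \<le> \<epsilon> / D * ((\<Sum>y\<in>e \<union> f - {x}. dev y) + K * (real ((r - 1) + (r - 1)))\<^sup>2)"
        using survive_approx[of "e \<union> f - {x}"] sub unfolding cards U_def power_add by auto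
      also have "\<dots> \<le> \<epsilon> / D * (g e + g f + K * (2 * real r)\<^sup>2)"
        using ed dev_un by (intro mult_left_mono add_mono power_mono) auto
      finally show ?thesis by simp
    qed
    have "(X e A - U) * (X f A - U) = of_bool ((e \<union> f - {x}) \<inter> \<Union>A = {})
        - U * X e A - U * X f A + U * U" for A
      unfolding XX[symmetric] by (simp add: algebra_simps)
    then have "expect q E (\<lambda>A. (X e A - U) * (X f A - U)) =
        survive (e \<union> f - {x}) - U * survive (e - {x}) - U * survive (f - {x}) + U * U"
      unfolding survive_def X_def by (simp only: expect_add expect_diff expect_scale expect_const[OF finE])
    also have "\<dots> = (survive (e \<union> f - {x}) - U * U) + U * (U - survive (e - {x})) + U * (U - survive (f - {x}))"
      by (simp add: algebra_simps)
    \<comment> \<open>The factor 6 of the claim is 4 + 1 + 1: (2 r)^2 K from the union of the two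
      edges and r^2 K from each edge.\<close>
    also have "\<dots> \<le> \<epsilon> / D * (g e + g f + K * (4 * (real r)\<^sup>2)) + 1 * (\<epsilon> / D * (g e + K * (real r)\<^sup>2))
        + 1 * (\<epsilon> / D * (g f + K * (real r)\<^sup>2))"
    proof (intro add_mono)
      show "U * (U - survive (e - {x})) \<le> 1 * (\<epsilon> / D * (g e + K * (real r)\<^sup>2))"
        using Pe U by (intro order_trans[OF mult_left_mono[of _ "\<bar>survive (e - {x}) - U\<bar>"] mult_mono]) auto
      show "U * (U - survive (f - {x})) \<le> 1 * (\<epsilon> / D * (g f + K * (real r)\<^sup>2))"
        using Pf U by (intro order_trans[OF mult_left_mono[of _ "\<bar>survive (f - {x}) - U\<bar>"] mult_mono]) auto
    qed (use Pef in \<open>simp add: abs_le_iff\<close>)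
    also have "\<dots> = \<epsilon> / D * (2 * g e + 2 * g f + 6 * (real r)\<^sup>2 * K)" by (simp add: algebra_simps)
    finally show ?thesis using False by simp
  qed
  have cardI: "(\<Sum>e\<in>?Ex. \<Sum>f\<in>?Ex. of_bool ((e, f) \<in> I)) \<le> d * r * K"
  proof -
    have finI: "finite I" and Isub: "I \<subseteq> ?Ex \<times> ?Ex"
      unfolding I_def using finEx by (auto intro: finite_subset[of _ "?Ex \<times> ?Ex"])
    have "(\<Sum>e\<in>?Ex. \<Sum>f\<in>?Ex. of_bool ((e, f) \<in> I)) = (\<Sum>z\<in>?Ex \<times> ?Ex. if z \<in> I then 1 else 0 :: real)"
      unfolding sum.cartesian_product by (intro sum.cong) auto
    also have "\<dots> = real (card I)"
      using finEx Isub by (simp add: sum.If_cases Int_absorb1)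
    also have "\<dots> \<le> real (degree_in E x * (r * K))"
      using intersecting_pairs[OF x] unfolding I_def of_nat_le_iff .
    finally show ?thesis by (simp add: d_def)
  qed
  have linear: "(\<Sum>e\<in>S. \<Sum>f\<in>S. c * h e f + b e f) = c * (\<Sum>e\<in>S. \<Sum>f\<in>S. h e f) + (\<Sum>e\<in>S. \<Sum>f\<in>S. b e f)"
    for S :: "'a set set" and c :: real and h b
    by (simp add: sum.distrib sum_distrib_left)
  have "expect q E (\<lambda>A. (real (open_edges x A) - d * U)\<^sup>2) = (\<Sum>e\<in>?Ex. \<Sum>f\<in>?Ex. expect q E (\<lambda>A. (X e A - U) * (X f A - U)))"
    unfolding sq expect_sum ..
  also have "\<dots> \<le> (\<Sum>e\<in>?Ex. \<Sum>f\<in>?Ex. \<epsilon> / D * (2 * g e + 2 * g f + 6 * (real r)\<^sup>2 * K) + of_bool ((e, f) \<in> I))"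
    by (intro sum_mono pair)
  also have "\<dots> = \<epsilon> / D * (\<Sum>e\<in>?Ex. \<Sum>f\<in>?Ex. 2 * g e + 2 * g f + 6 * (real r)\<^sup>2 * K)
      + (\<Sum>e\<in>?Ex. \<Sum>f\<in>?Ex. of_bool ((e, f) \<in> I))"
    by (rule linear)
  also have "(\<Sum>e\<in>?Ex. \<Sum>f\<in>?Ex. 2 * g e + 2 * g f + 6 * (real r)\<^sup>2 * K)
      = 4 * d * (\<Sum>e\<in>?Ex. g e) + 6 * (real r)\<^sup>2 * K * d\<^sup>2"
  proof -
    have d: "real (card ?Ex) = d" by (simp add: d_def degree_in_def)
    have "(\<Sum>f\<in>?Ex. 2 * g f) = 2 * (\<Sum>e\<in>?Ex. g e)" by (rule sum_distrib_left[symmetric])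
    then have "(\<Sum>e\<in>?Ex. \<Sum>f\<in>?Ex. 2 * g e) = d * (2 * (\<Sum>e\<in>?Ex. g e))"
      "(\<Sum>e\<in>?Ex. \<Sum>f\<in>?Ex. 2 * g f) = d * (2 * (\<Sum>e\<in>?Ex. g e))"
      by (simp_all only: sum_constant d sum_distrib_left[of d, symmetric])
    then show ?thesis by (simp only: sum.distrib sum_constant d) (simp add: power2_eq_square)
  qed
  finally show ?thesis using cardI unfolding g_def by simp
qed

definition left_edges where "left_edges A = {e \<in> E. e \<subseteq> W - \<Union>A}"

text \<open>The total deviation with which the next round starts. A surviving vertex keeps an edge
  when its r - 1 other vertices survive, whence the new nominal degree.\<close>

definition new_dev where
  "new_dev A = (\<Sum>x\<in>W - \<Union>A. \<bar>real (degree_in (left_edges A) x) - D * exp (- \<epsilon>) ^ (r - 1)\<bar>)"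

lemma left_degree:
  assumes "x \<in> W - \<Union>A"
  shows "degree_in (left_edges A) x = open_edges x A"
  unfolding degree_in_def left_edges_def open_edges_def
  using assms edge by (intro arg_cong[of _ _ card]) fast

text \<open>Incidences are counted twice: the sum moves from vertices to edges, where each edge
  occurs r times, and back to vertices. Each passage costs one degree bound
  \<open>D0\<close>.\<close>

lemma sum_edges_dev:
  "(\<Sum>x\<in>W. real (degree_in E x) * (\<Sum>e\<in>{e \<in> E. x \<in> e}. \<Sum>y\<in>e. dev y)) \<le> D0\<^sup>2 * r * (\<Sum>y\<in>W. dev y)"
proof (cases "W = {}")
  case False
  then have D0: "0 \<le> D0" using degree_le by fastforce
  define g where "g e = (\<Sum>y\<in>e. dev y)" for e
  have g: "0 \<le> g e" for e unfolding g_def by (intro sum_nonneg dev_nonneg)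
  have double: "(\<Sum>x\<in>W. \<Sum>e\<in>{e \<in> E. x \<in> e}. h x e) = (\<Sum>e\<in>E. \<Sum>x\<in>e. h x e)" for h :: "'a \<Rightarrow> 'a set \<Rightarrow> real"
  proof -
    have "(\<Sum>x\<in>W. \<Sum>e\<in>{e \<in> E. x \<in> e}. h x e) = (\<Sum>e\<in>E. \<Sum>x\<in>{x \<in> W. x \<in> e}. h x e)"
      by (rule sum.swap_restrict[OF finW finE])
    also have "\<dots> = (\<Sum>e\<in>E. \<Sum>x\<in>e. h x e)"
      using edge by (intro sum.cong) auto
    finally show ?thesis .
  qed
  have "(\<Sum>x\<in>W. real (degree_in E x) * (\<Sum>e\<in>{e \<in> E. x \<in> e}. g e)) \<le> (\<Sum>x\<in>W. D0 * (\<Sum>e\<in>{e \<in> E. x \<in> e}. g e))"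
    using degree_le g by (intro sum_mono mult_right_mono sum_nonneg) auto
  also have "\<dots> = D0 * (\<Sum>e\<in>E. \<Sum>x\<in>e. g e)" by (simp only: sum_distrib_left[symmetric] double)
  also have "(\<Sum>e\<in>E. \<Sum>x\<in>e. g e) = r * (\<Sum>e\<in>E. \<Sum>y\<in>e. dev y)"
    using edge by (simp add: g_def sum_distrib_left)
  also have "(\<Sum>e\<in>E. \<Sum>y\<in>e. dev y) = (\<Sum>y\<in>W. \<Sum>e\<in>{e \<in> E. y \<in> e}. dev y)" by (rule double[symmetric])
  also have "\<dots> = (\<Sum>y\<in>W. real (degree_in E y) * dev y)" by (simp add: degree_in_def)
  also have "D0 * (r * \<dots>) \<le> D0 * (r * (\<Sum>y\<in>W. D0 * dev y))"
    using degree_le dev_nonneg D0 by (intro mult_left_mono sum_mono mult_right_mono) auto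
  also have "\<dots> = D0\<^sup>2 * r * (\<Sum>y\<in>W. dev y)"
    by (simp add: sum_distrib_left[symmetric] power2_eq_square)
  finally show ?thesis unfolding g_def .
qed simp

text \<open>The estimate |z| <= b + z^2 / b takes the place of Cauchy-Schwarz. It is linear in z^2,
  so expectations can be taken term by term, and \<open>b\<close> remains free to be
  optimized.\<close>

lemma expect_new_dev:
  fixes b :: real
  assumes b: "0 < b"
  shows "expect q E new_dev \<le> (\<Sum>y\<in>W. dev y) + b * card W
    + (\<epsilon> / D * (4 * r * D0\<^sup>2 * (\<Sum>y\<in>W. dev y) + 6 * (real r)\<^sup>2 * K * D0\<^sup>2 * card W) + D0 * r * K * card W) / b"
proof -
  define U where "U = exp (- \<epsilon>) ^ (r - 1)"
  have U: "0 \<le> U" "U \<le> 1" unfolding U_def using eps by (auto intro: power_le_one)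
  let ?d = "\<lambda>x. real (degree_in E x)"
  let ?V = "\<lambda>x A. (real (open_edges x A) - ?d x * U)\<^sup>2"
  have ed: "0 \<le> \<epsilon> / D" using eps D by simp
  have point: "new_dev A \<le> (\<Sum>x\<in>W. dev x + b + 1 / b * ?V x A)" if "A \<subseteq> E" for A
  proof -
    have "new_dev A = (\<Sum>x\<in>W - \<Union>A. \<bar>real (open_edges x A) - D * U\<bar>)"
      unfolding new_dev_def U_def by (intro sum.cong) (auto simp: left_degree)
    also have "\<dots> \<le> (\<Sum>x\<in>W. \<bar>real (open_edges x A) - D * U\<bar>)"
      using finW by (intro sum_mono2) auto
    also have "\<dots> \<le> (\<Sum>x\<in>W. dev x + b + 1 / b * ?V x A)"
    proof (rule sum_mono)
      fix x assume "x \<in> W"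
      have "\<bar>real (open_edges x A) - D * U\<bar> = \<bar>(real (open_edges x A) - ?d x * U) + (?d x - D) * U\<bar>"
        by (simp add: algebra_simps)
      also have "\<dots> \<le> \<bar>real (open_edges x A) - ?d x * U\<bar> + dev x * U"
        unfolding dev_def using U by (simp add: abs_mult order_trans[OF abs_triangle_ineq])
      also have "dev x * U \<le> dev x * 1" using U dev_nonneg by (intro mult_left_mono) auto
      also have "\<bar>z\<bar> \<le> b + 1 / b * z\<^sup>2" for z
      proof -
        have "0 \<le> (\<bar>z\<bar> - b)\<^sup>2 + b * \<bar>z\<bar>" using b by simp
        then have "b * \<bar>z\<bar> \<le> b * b + z\<^sup>2" by (simp add: power2_eq_square algebra_simps)
        then show ?thesis using b by (simp add: field_simps)
      qed
      finally show "\<bar>real (open_edges x A) - D * U\<bar> \<le> dev x + b + 1 / b * ?V x A" by simp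
    qed
    finally show ?thesis .
  qed
  have V: "expect q E (?V x) \<le> \<epsilon> / D * (4 * (?d x * (\<Sum>e\<in>{e \<in> E. x \<in> e}. \<Sum>y\<in>e. dev y)) + 6 * (real r)\<^sup>2 * K * D0\<^sup>2) + D0 * r * K"
    if "x \<in> W" for x
  proof -
    have "expect q E (?V x) \<le> \<epsilon> / D * (4 * ?d x * (\<Sum>e\<in>{e \<in> E. x \<in> e}. \<Sum>y\<in>e. dev y) + 6 * (real r)\<^sup>2 * K * (?d x)\<^sup>2) + ?d x * r * K"
      unfolding U_def by (rule expect_open_edges[OF that])
    also have "\<dots> \<le> \<epsilon> / D * (4 * ?d x * (\<Sum>e\<in>{e \<in> E. x \<in> e}. \<Sum>y\<in>e. dev y) + 6 * (real r)\<^sup>2 * K * D0\<^sup>2) + D0 * r * K"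
      using degree_le[OF that] ed
      by (intro add_mono mult_left_mono mult_right_mono power_mono order_refl) auto
    finally show ?thesis by (simp only: mult.assoc)
  qed
  have "expect q E new_dev \<le> expect q E (\<lambda>A. \<Sum>x\<in>W. dev x + b + 1 / b * ?V x A)"
    using point q by (intro expect_mono) auto
  also have "\<dots> = (\<Sum>x\<in>W. dev x + b + 1 / b * expect q E (?V x))"
    by (simp only: expect_sum expect_add expect_scale expect_const[OF finE])
  also have "\<dots> \<le> (\<Sum>x\<in>W. dev x + b + 1 / b * (\<epsilon> / D * (4 * (?d x * (\<Sum>e\<in>{e \<in> E. x \<in> e}. \<Sum>y\<in>e. dev y)) + 6 * (real r)\<^sup>2 * K * D0\<^sup>2) + D0 * r * K))"
    using V b by (intro sum_mono add_mono mult_left_mono order_refl) auto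
  also have "\<dots> = (\<Sum>y\<in>W. dev y) + b * card W + 1 / b * (\<epsilon> / D * (4 * (\<Sum>x\<in>W. ?d x * (\<Sum>e\<in>{e \<in> E. x \<in> e}. \<Sum>y\<in>e. dev y))
      + 6 * (real r)\<^sup>2 * K * D0\<^sup>2 * card W) + D0 * r * K * card W)"
    by (simp only: sum.distrib sum_distrib_left[symmetric] sum_constant distrib_left) (simp only: mult_ac)
  also have "\<dots> \<le> (\<Sum>y\<in>W. dev y) + b * card W + 1 / b * (\<epsilon> / D * (4 * (D0\<^sup>2 * r * (\<Sum>y\<in>W. dev y))
      + 6 * (real r)\<^sup>2 * K * D0\<^sup>2 * card W) + D0 * r * K * card W)"
    using sum_edges_dev ed b by (intro add_mono mult_left_mono order_refl) auto
  finally show ?thesis by (simp add: mult_ac)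
qed

end

section \<open>Choosing a good round and iterating\<close>

context hypergraph begin

text \<open>A single \<open>A\<close> has to do well for the leftover, the waste and the new
  deviation. Weights \<open>B\<close> and \<open>1 / (\<alpha> * D0)\<close> merge the three into
  one random variable, to which the first moment method applies. Degrees are measured in units of
  \<open>D0\<close>, so the codegree terms become K / D0 and vanish for large degrees.\<close>

lemma nibble_step:
  fixes N \<eta> c b B \<alpha> :: real
  assumes N: "card W \<le> N" and dev: "(\<Sum>y\<in>W. dev y) \<le> \<eta> * D0 * N" and c: "0 < c" "c * D0 \<le> D"
    and D0: "0 < D0" and pos: "0 \<le> \<eta>" "0 < \<alpha>" "0 < b" "0 \<le> B"
  shows "\<exists>A\<subseteq>E. card (W - \<Union>A) + B * card (collided A) + new_dev A / (\<alpha> * D0) \<le>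
    exp (- \<epsilon>) * card W + N * (\<epsilon> / c * (\<eta> + K / D0) + B * r * (\<epsilon> / c)\<^sup>2
      + (\<eta> + b + (\<epsilon> / c * (4 * r * \<eta> + 6 * (real r)\<^sup>2 * K / D0) + r * K / D0) / b) / \<alpha>)"
proof -
  have N0: "0 \<le> N" using N by (meson of_nat_0_le_iff order_trans)
  have ed: "\<epsilon> / D \<le> \<epsilon> / (c * D0)" "0 \<le> \<epsilon> / D" using c D D0 eps by (auto intro!: divide_left_mono)
  have left: "expect q E (\<lambda>A. card (W - \<Union>A)) \<le> exp (- \<epsilon>) * card W + N * (\<epsilon> / c * (\<eta> + K / D0))"
  proof -
    have "\<epsilon> / D * ((\<Sum>y\<in>W. dev y) + K * card W) \<le> \<epsilon> / (c * D0) * (\<eta> * D0 * N + K * N)"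
      using ed dev mult_left_mono[OF N, of K] D0 c eps dev_nonneg
      by (intro mult_mono add_mono add_nonneg_nonneg sum_nonneg) auto
    also have "\<dots> = N * (\<epsilon> / c * (\<eta> + K / D0))" using c D0 by (simp add: field_simps)
    finally show ?thesis using expect_left by simp
  qed
  have coll: "expect q E (\<lambda>A. card (collided A)) \<le> N * (r * (\<epsilon> / c)\<^sup>2)"
  proof -
    have "r * (\<epsilon> / D)\<^sup>2 * (D0\<^sup>2 * card W) \<le> r * (\<epsilon> / (c * D0))\<^sup>2 * (D0\<^sup>2 * N)"
      using ed N by (intro mult_mono power_mono mult_left_mono) auto
    also have "\<dots> = N * (r * (\<epsilon> / c)\<^sup>2)" using c D0 by (simp add: field_simps power2_eq_square)
    finally show ?thesis using expect_collided by linarith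
  qed
  have new: "expect q E new_dev \<le> D0 * (N * (\<eta> + b + (\<epsilon> / c * (4 * r * \<eta> + 6 * (real r)\<^sup>2 * K / D0) + r * K / D0) / b))"
  proof -
    have "expect q E new_dev \<le> (\<Sum>y\<in>W. dev y) + (b * D0) * card W
      + (\<epsilon> / D * (4 * r * D0\<^sup>2 * (\<Sum>y\<in>W. dev y) + 6 * (real r)\<^sup>2 * K * D0\<^sup>2 * card W) + D0 * r * K * card W) / (b * D0)"
      using pos D0 by (intro expect_new_dev) auto
    also have "\<dots> \<le> \<eta> * D0 * N + (b * D0) * N
      + (\<epsilon> / (c * D0) * (4 * r * D0\<^sup>2 * (\<eta> * D0 * N) + 6 * (real r)\<^sup>2 * K * D0\<^sup>2 * N) + D0 * r * K * N) / (b * D0)"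
      using ed dev N N0 D0 c eps pos dev_nonneg
      by (intro add_mono mult_mono divide_right_mono mult_left_mono add_nonneg_nonneg sum_nonneg mult_nonneg_nonneg) auto
    also have "\<dots> = D0 * (N * (\<eta> + b + (\<epsilon> / c * (4 * r * \<eta> + 6 * (real r)\<^sup>2 * K / D0) + r * K / D0) / b))"
      using c D0 pos by (simp add: field_simps power2_eq_square)
    finally show ?thesis .
  qed
  let ?f = "\<lambda>A. real (card (W - \<Union>A)) + B * card (collided A) + 1 / (\<alpha> * D0) * new_dev A"
  obtain A where A: "A \<subseteq> E" "?f A \<le> expect q E ?f"
    using expect_attained[OF finE q(1,2), of ?f] by auto
  have "expect q E ?f = expect q E (\<lambda>A. card (W - \<Union>A)) + B * expect q E (\<lambda>A. card (collided A)) + 1 / (\<alpha> * D0) * expect q E new_dev"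
    by (simp only: expect_add expect_scale)
  also have "\<dots> \<le> (exp (- \<epsilon>) * card W + N * (\<epsilon> / c * (\<eta> + K / D0))) + B * (N * (r * (\<epsilon> / c)\<^sup>2))
     + 1 / (\<alpha> * D0) * (D0 * (N * (\<eta> + b + (\<epsilon> / c * (4 * r * \<eta> + 6 * (real r)\<^sup>2 * K / D0) + r * K / D0) / b)))"
    using left coll new pos D0 by (intro add_mono mult_left_mono) auto
  also have "1 / (\<alpha> * D0) * (D0 * (N * (\<eta> + b + (\<epsilon> / c * (4 * r * \<eta> + 6 * (real r)\<^sup>2 * K / D0) + r * K / D0) / b)))
    = N * ((\<eta> + b + (\<epsilon> / c * (4 * r * \<eta> + 6 * (real r)\<^sup>2 * K / D0) + r * K / D0) / b) / \<alpha>)"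
    using D0 by simp
  finally show ?thesis using A
    by (intro exI[of _ A]) (simp add: algebra_simps)
qed

lemma hypergraph_left:
  "hypergraph (W - \<Union>A) (left_edges A) r K (D * exp (- \<epsilon>) ^ (r - 1)) D0 \<epsilon>"
proof
  show "e \<subseteq> W - \<Union>A \<and> card e = r" if "e \<in> left_edges A" for e
    using that edge by (auto simp: left_edges_def)
  have sub: "left_edges A \<subseteq> E" by (auto simp: left_edges_def)
  show "real (degree_in (left_edges A) x) \<le> D0" if "x \<in> W - \<Union>A" for x
  proof -
    have "degree_in (left_edges A) x \<le> degree_in E x"
      unfolding degree_in_def using sub finE by (intro card_mono) auto
    then show ?thesis using degree_le[of x] that by simp
  qed
  show "card {e \<in> left_edges A. x \<in> e \<and> y \<in> e} \<le> K" if "x \<in> W - \<Union>A" "y \<in> W - \<Union>A" "x \<noteq> y" for x y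
  proof -
    have "card {e \<in> left_edges A. x \<in> e \<and> y \<in> e} \<le> card {e \<in> E. x \<in> e \<and> y \<in> e}"
      using sub finE by (intro card_mono) auto
    then show ?thesis using codegree[of x y] that by simp
  qed
qed (use finW D eps in auto)

end

text \<open>\<open>W'\<close> is the part not yet treated after \<open>j\<close> rounds, and \<open>W - \<Union>M - W'\<close> consists of the vertices wasted
  by collisions. Bounding \<open>B\<close> times the waste together with \<open>card W'\<close> makes the total waste telescope.\<close>

lemma nibble_iterate:
  fixes c \<epsilon> \<kappa> B :: real and r K :: nat
  assumes c: "0 < c" and eps: "0 < \<epsilon>" and B: "0 \<le> B" and \<kappa>: "B * r * (\<epsilon> / c)\<^sup>2 < \<kappa>"
  shows "\<exists>\<eta>>0. \<exists>T. \<forall>(W :: 'a set) E D D0 (N :: real). hypergraph W E r K D D0 \<epsilon> \<longrightarrow> card W \<le> N \<longrightarrow>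
    (\<Sum>y\<in>W. hypergraph.dev E D y) \<le> \<eta> * D0 * N \<longrightarrow> T \<le> D0 \<longrightarrow> c * D0 \<le> D * exp (- \<epsilon>) ^ ((r - 1) * j) \<longrightarrow>
    (\<exists>M W'. M \<subseteq> E \<and> disjoint M \<and> W' \<subseteq> W - \<Union>M \<and>
      B * card (W - \<Union>M - W') \<le> card W + j * \<kappa> * N \<and> card W' \<le> exp (- \<epsilon>) ^ j * card W + j * \<kappa> * N)"
proof (induction j)
  case 0
  show ?case
    by (intro exI[of _ 1] conjI exI[of _ 0] allI impI, simp) (rule exI[of _ "{}"], use B in auto)
next
  \<comment> \<open>The round carried out here is the first of j + 1, so the accuracy required at
    the start is computed backwards from what the j later rounds require.\<close>
  case (Suc j)
  then obtain \<eta>' T' where \<eta>': "0 < \<eta>'" and IH: "\<And>(W :: 'a set) E D D0 (N :: real). hypergraph W E r K D D0 \<epsilon> \<Longrightarrow> card W \<le> N \<Longrightarrow>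
    (\<Sum>y\<in>W. hypergraph.dev E D y) \<le> \<eta>' * D0 * N \<Longrightarrow> T' \<le> D0 \<Longrightarrow> c * D0 \<le> D * exp (- \<epsilon>) ^ ((r - 1) * j) \<Longrightarrow>
    (\<exists>M W'. M \<subseteq> E \<and> disjoint M \<and> W' \<subseteq> W - \<Union>M \<and>
      B * card (W - \<Union>M - W') \<le> card W + j * \<kappa> * N \<and> card W' \<le> exp (- \<epsilon>) ^ j * card W + j * \<kappa> * N)"
    by blast
  \<comment> \<open>The slack beyond the waste term; \<open>b\<close>, \<open>\<eta>\<close> and
    \<open>T\<close> each spend a quarter of it.\<close>
  define g where "g = \<kappa> - B * r * (\<epsilon> / c)\<^sup>2"
  have g: "0 < g" using \<kappa> by (simp add: g_def)
  have "0 \<le> B * r * (\<epsilon> / c)\<^sup>2" using B by simp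
  then have \<kappa>0: "0 < \<kappa>" using \<kappa> by linarith
  \<comment> \<open>The weighted deviation will be at most (1 + \<kappa>) N; with this weight that
    bound reads \<open>\<eta>' * D0 * N\<close>, as the induction hypothesis demands.\<close>
  define \<alpha> where "\<alpha> = \<eta>' / (1 + \<kappa>)"
  have \<alpha>: "0 < \<alpha>" using \<eta>' \<kappa>0 by (simp add: \<alpha>_def)
  define b where "b = \<alpha> * g / 4"
  have b: "0 < b" using \<alpha> g by (simp add: b_def)
  define C1 where "C1 = \<epsilon> / c + 1 / \<alpha> + \<epsilon> / c * (4 * r) / b / \<alpha>"
  have C1: "0 < C1"
  proof -
    have "0 < \<epsilon> / c" "0 < 1 / \<alpha>" "0 \<le> \<epsilon> / c * (4 * r) / b / \<alpha>" using eps c \<alpha> b by auto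
    then show ?thesis unfolding C1_def by linarith
  qed
  define C2 where "C2 = \<epsilon> / c * K + (\<epsilon> / c * (6 * (real r)\<^sup>2 * K) + r * K) / b / \<alpha>"
  have C2: "0 \<le> C2" using eps c \<alpha> b by (auto simp: C2_def intro!: add_nonneg_nonneg)
  define \<eta> where "\<eta> = g / (4 * C1)"
  have \<eta>: "0 < \<eta>" using g C1 by (simp add: \<eta>_def)
  define T where "T = max (max 1 T') (4 * C2 / g)"
  show ?case
  proof (rule exI[of _ \<eta>], rule conjI[OF \<eta>], rule exI[of _ T], intro allI impI)
    fix W :: "'a set" and E D D0 and N :: real
    assume H: "hypergraph W E r K D D0 \<epsilon>" and N: "card W \<le> N"
      and dev: "(\<Sum>y\<in>W. hypergraph.dev E D y) \<le> \<eta> * D0 * N" and T: "T \<le> D0"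
      and cD: "c * D0 \<le> D * exp (- \<epsilon>) ^ ((r - 1) * Suc j)"
    interpret hypergraph W E r K D D0 \<epsilon> by (rule H)
    have N0: "0 \<le> N" using N by (meson of_nat_0_le_iff order_trans)
    have D0: "1 \<le> D0" "T' \<le> D0" "4 * C2 / g \<le> D0" using T by (auto simp: T_def)
    then have "C2 / D0 \<le> g / 4" using g by (simp add: field_simps)
    have u: "0 < exp (- \<epsilon>)" "exp (- \<epsilon>) \<le> 1" using eps by auto
    have "D * exp (- \<epsilon>) ^ ((r - 1) * Suc j) \<le> D * 1"
      using u D by (intro mult_left_mono power_le_one) auto
    then have cD': "c * D0 \<le> D" using cD by simp
    have D00: "0 < D0" using D0 by simp
    let ?X = "\<epsilon> / c * (\<eta> + K / D0) + B * r * (\<epsilon> / c)\<^sup>2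
      + (\<eta> + b + (\<epsilon> / c * (4 * r * \<eta> + 6 * (real r)\<^sup>2 * K / D0) + r * K / D0) / b) / \<alpha>"
    have X: "?X \<le> \<kappa>"
    proof -
      have "?X = B * r * (\<epsilon> / c)\<^sup>2 + b / \<alpha> + \<eta> * C1 + C2 / D0"
        unfolding C1_def C2_def using D00 \<alpha> b c by (simp add: field_simps)
      also have "\<dots> \<le> B * r * (\<epsilon> / c)\<^sup>2 + g / 4 + g / 4 + g / 4"
        using \<open>C2 / D0 \<le> g / 4\<close> \<alpha> C1 by (simp add: b_def \<eta>_def)
      also have "\<dots> \<le> B * r * (\<epsilon> / c)\<^sup>2 + g" using g by linarith
      also have "\<dots> = \<kappa>" by (simp add: g_def)
      finally show ?thesis .
    qed
    obtain A where A: "A \<subseteq> E" and le: "card (W - \<Union>A) + B * card (collided A) + new_dev A / (\<alpha> * D0) \<le>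
        exp (- \<epsilon>) * card W + N * ?X"
      using nibble_step[OF N dev c cD' D00 less_imp_le[OF \<eta>] \<alpha> b B] by blast
    have "N * ?X \<le> N * \<kappa>" using X N0 by (rule mult_left_mono)
    with le have le: "card (W - \<Union>A) + B * card (collided A) + new_dev A / (\<alpha> * D0) \<le> exp (- \<epsilon>) * card W + \<kappa> * N"
      by (simp add: mult.commute)
    have nd: "0 \<le> new_dev A / (\<alpha> * D0)" "0 \<le> B * card (collided A)"
      using \<alpha> D00 B by (auto simp: new_dev_def intro!: divide_nonneg_nonneg sum_nonneg)
    have uW: "exp (- \<epsilon>) * card W \<le> card W" using u by (intro mult_left_le_one_le) auto
    let ?W = "W - \<Union>A" and ?E = "left_edges A" and ?D = "D * exp (- \<epsilon>) ^ (r - 1)"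
    have H': "hypergraph ?W ?E r K ?D D0 \<epsilon>" by (rule hypergraph_left)
    have "new_dev A / (\<alpha> * D0) \<le> (1 + \<kappa>) * N"
      using le nd uW N by (simp add: algebra_simps)
    then have "new_dev A \<le> (1 + \<kappa>) * N * (\<alpha> * D0)"
      using \<alpha> D00 by (simp add: pos_divide_le_eq)
    also have "\<dots> = \<eta>' * D0 * N" using \<kappa>0 by (simp add: \<alpha>_def)
    finally have "new_dev A \<le> \<eta>' * D0 * N" .
    moreover have "new_dev A = (\<Sum>y\<in>?W. hypergraph.dev ?E ?D y)"
      unfolding new_dev_def hypergraph.dev_def[OF H'] ..
    ultimately have dev': "(\<Sum>y\<in>?W. hypergraph.dev ?E ?D y) \<le> \<eta>' * D0 * N" by simp
    have cardW: "card ?W \<le> N"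
    proof -
      have "card ?W \<le> card W" using finW by (intro card_mono) auto
      then show ?thesis using N by linarith
    qed
    have cD2: "c * D0 \<le> ?D * exp (- \<epsilon>) ^ ((r - 1) * j)"
      using cD by (simp add: power_add mult.assoc)
    obtain M W' where M: "M \<subseteq> ?E" "disjoint M" "W' \<subseteq> ?W - \<Union>M"
      "B * card (?W - \<Union>M - W') \<le> card ?W + j * \<kappa> * N" "card W' \<le> exp (- \<epsilon>) ^ j * card ?W + j * \<kappa> * N"
      using IH[OF H' cardW dev' D0(2) cD2] by blast
    \<comment> \<open>Only edges of \<open>A\<close> that meet no other edge of \<open>A\<close>
      enter the matching. Later edges avoid all of \<open>\<Union>A\<close>, so they cannot meet
      these.\<close>
    define I where "I = {e \<in> A. \<forall>f\<in>A. f \<noteq> e \<longrightarrow> e \<inter> f = {}}"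
    have I: "\<Union>I \<subseteq> \<Union>A" by (auto simp: I_def)
    have UM: "\<Union>M \<subseteq> W - \<Union>A" using M(1) by (auto simp: left_edges_def)
    have "I \<union> M \<subseteq> E" using A M(1) by (auto simp: I_def left_edges_def)
    moreover have "disjoint (I \<union> M)"
    proof (rule disjoint_union)
      show "disjoint I" unfolding disjoint_def I_def by blast
      show "\<Union>I \<inter> \<Union>M = {}" using I UM by blast
    qed (rule M(2))
    moreover have "W' \<subseteq> W - \<Union>(I \<union> M)" using M(3) I by blast
    moreover have "B * card (W - \<Union>(I \<union> M) - W') \<le> card W + Suc j * \<kappa> * N"
    proof -
      have fin: "finite (collided A)"
        by (rule finite_subset[OF _ finW]) (use A edge in \<open>auto simp: collided_def\<close>)
      have "W - \<Union>(I \<union> M) - W' \<subseteq> collided A \<union> (?W - \<Union>M - W')"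
        unfolding I_def collided_def by blast
      then have "card (W - \<Union>(I \<union> M) - W') \<le> card (collided A \<union> (?W - \<Union>M - W'))"
        using fin finW by (intro card_mono) auto
      also have "\<dots> \<le> card (collided A) + card (?W - \<Union>M - W')" by (rule card_Un_le)
      finally have "B * real (card (W - \<Union>(I \<union> M) - W')) \<le> B * real (card (collided A) + card (?W - \<Union>M - W'))"
        using B by (intro mult_left_mono) (simp_all only: of_nat_le_iff)
      also have "\<dots> = B * card (collided A) + B * card (?W - \<Union>M - W')" by (simp add: distrib_left)
      also have "\<dots> \<le> card W + Suc j * \<kappa> * N"
        using M(4) le nd uW by (simp add: algebra_simps)
      finally show ?thesis .
    qed
    moreover have "card W' \<le> exp (- \<epsilon>) ^ Suc j * card W + Suc j * \<kappa> * N"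
    proof -
      have "real (card W') \<le> exp (- \<epsilon>) ^ j * (exp (- \<epsilon>) * card W + \<kappa> * N) + j * \<kappa> * N"
        using M(5) le nd u by (elim order_trans) (intro add_right_mono mult_left_mono, auto)
      also have "\<dots> = exp (- \<epsilon>) ^ Suc j * card W + exp (- \<epsilon>) ^ j * (\<kappa> * N) + j * \<kappa> * N"
        by (simp add: algebra_simps)
      also have "exp (- \<epsilon>) ^ j * (\<kappa> * N) \<le> 1 * (\<kappa> * N)"
        using u \<kappa>0 N0 by (intro mult_right_mono power_le_one) auto
      finally show ?thesis by (simp add: algebra_simps)
    qed
    ultimately show "\<exists>M W'. M \<subseteq> E \<and> disjoint M \<and> W' \<subseteq> W - \<Union>M \<and>
      B * card (W - \<Union>M - W') \<le> card W + Suc j * \<kappa> * N \<and> card W' \<le> exp (- \<epsilon>) ^ Suc j * card W + Suc j * \<kappa> * N"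
      by blast
  qed
qed

theorem near_perfect_matching:
  fixes \<delta> :: real and r K :: nat
  assumes \<delta>: "0 < \<delta>"
  shows "\<exists>T. \<forall>(W :: 'a set) E (D :: real). finite W \<longrightarrow> (\<forall>e\<in>E. e \<subseteq> W \<and> card e = r) \<longrightarrow>
    (\<forall>x\<in>W. D - 1 \<le> degree_in E x \<and> degree_in E x \<le> D) \<longrightarrow>
    (\<forall>x\<in>W. \<forall>y\<in>W. x \<noteq> y \<longrightarrow> card {e \<in> E. x \<in> e \<and> y \<in> e} \<le> K) \<longrightarrow> T \<le> D \<longrightarrow>
    (\<exists>M\<subseteq>E. disjoint M \<and> card (W - \<Union>M) \<le> \<delta> * card W)"
proof -
  \<comment> \<open>\<open>L\<close> is the total duration J \<epsilon> of the process, after which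
    a share of about exp (- L) of the vertices is still untreated.\<close>
  define L where "L = max 1 (ln (4 / \<delta>))"
  have L: "0 < L" "exp (- L) \<le> \<delta> / 4"
  proof -
    have "exp (- L) \<le> exp (- ln (4 / \<delta>))" by (simp add: L_def)
    also have "\<dots> = \<delta> / 4" using \<delta> by (simp add: exp_minus)
    finally show "exp (- L) \<le> \<delta> / 4" .
  qed (simp add: L_def)
  \<comment> \<open>The factor by which the nominal degree has dropped at the end, hence a lower
    bound for it in all rounds.\<close>
  define c where "c = exp (- L) ^ (r - 1)"
  have c: "0 < c" by (simp add: c_def)
  \<comment> \<open>\<open>B\<close> times the waste will be at most 2 |W|, so the waste is at most
    half of the allowance \<delta> |W|.\<close>
  define B where "B = 4 / \<delta>"
  have B: "0 < B" using \<delta> by (simp add: B_def)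
  \<comment> \<open>With \<epsilon> = L / J, the waste term is below C / J^2, strictly because of
    \<open>real r + 1\<close> instead of \<open>r\<close>. Over J rounds the error is C / J, which a
    large J makes small.\<close>
  define C where "C = B * (real r + 1) * (L / c)\<^sup>2"
  have C: "0 < C" using B L c by (simp add: C_def)
  obtain J :: nat where J: "C / min 1 (\<delta> / 4) < J" using reals_Archimedean2 by blast
  have "0 < C / min 1 (\<delta> / 4)" using C \<delta> by simp
  then have J0: "0 < J" using J by (metis of_nat_0_less_iff less_trans)
  have CJ: "C / J \<le> min 1 (\<delta> / 4)"
    using J J0 \<delta> C by (simp add: field_simps min_def split: if_splits)
  define \<epsilon> where "\<epsilon> = L / J"
  have eps: "0 < \<epsilon>" using L J0 by (simp add: \<epsilon>_def)
  define \<kappa> where "\<kappa> = C / (real J)\<^sup>2"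
  have J\<kappa>: "J * \<kappa> = C / J" using J0 by (simp add: \<kappa>_def power2_eq_square)
  have \<kappa>: "B * r * (\<epsilon> / c)\<^sup>2 < \<kappa>"
  proof -
    have "B * r * (\<epsilon> / c)\<^sup>2 = B * r * (L / c)\<^sup>2 / (real J)\<^sup>2"
      by (simp add: \<epsilon>_def power_divide power_mult_distrib mult.commute)
    also have "\<dots> < \<kappa>"
      unfolding \<kappa>_def C_def using B L c J0 by (intro divide_strict_right_mono mult_strict_right_mono mult_strict_left_mono) auto
    finally show ?thesis .
  qed
  have uJ: "exp (- \<epsilon>) ^ J = exp (- L)"
    using J0 by (simp add: \<epsilon>_def exp_of_nat_mult[symmetric])
  obtain \<eta> T where \<eta>: "0 < \<eta>" and nibble: "\<And>(W :: 'a set) E D D0 (N :: real). hypergraph W E r K D D0 \<epsilon> \<Longrightarrow> card W \<le> N \<Longrightarrow>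
    (\<Sum>y\<in>W. hypergraph.dev E D y) \<le> \<eta> * D0 * N \<Longrightarrow> T \<le> D0 \<Longrightarrow> c * D0 \<le> D * exp (- \<epsilon>) ^ ((r - 1) * J) \<Longrightarrow>
    (\<exists>M W'. M \<subseteq> E \<and> disjoint M \<and> W' \<subseteq> W - \<Union>M \<and>
      B * card (W - \<Union>M - W') \<le> card W + J * \<kappa> * N \<and> card W' \<le> exp (- \<epsilon>) ^ J * card W + J * \<kappa> * N)"
    using nibble_iterate[where 'a='a, OF c eps less_imp_le[OF B] \<kappa>, of K J] by blast
  show ?thesis
  proof (intro exI[of _ "max (max 1 T) (1 / \<eta>)"] allI impI)
    fix W :: "'a set" and E and D :: real
    assume fin: "finite W" and E: "\<forall>e\<in>E. e \<subseteq> W \<and> card e = r"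
      and deg: "\<forall>x\<in>W. D - 1 \<le> degree_in E x \<and> degree_in E x \<le> D"
      and codeg: "\<forall>x\<in>W. \<forall>y\<in>W. x \<noteq> y \<longrightarrow> card {e \<in> E. x \<in> e \<and> y \<in> e} \<le> K"
      and "max (max 1 T) (1 / \<eta>) \<le> D"
    then have D: "1 \<le> D" "T \<le> D" "1 / \<eta> \<le> D" by auto
    have H: "hypergraph W E r K D D \<epsilon>"
      by unfold_locales (use fin E deg codeg D eps in auto)
    have "(\<Sum>y\<in>W. hypergraph.dev E D y) \<le> (\<Sum>y\<in>W. 1)"
      using deg by (intro sum_mono) (auto simp: hypergraph.dev_def[OF H] abs_le_iff)
    also have "\<dots> \<le> \<eta> * D * card W"
    proof -
      have "1 \<le> \<eta> * D" using D(3) \<eta> by (simp add: field_simps)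
      then have "1 * real (card W) \<le> \<eta> * D * card W" by (intro mult_right_mono) auto
      then show ?thesis by simp
    qed
    finally have dev: "(\<Sum>y\<in>W. hypergraph.dev E D y) \<le> \<eta> * D * card W" .
    have "exp (- \<epsilon>) ^ ((r - 1) * J) = c"
      unfolding c_def uJ[symmetric] by (metis mult.commute power_mult)
    then have cD: "c * D \<le> D * exp (- \<epsilon>) ^ ((r - 1) * J)" by (simp add: mult.commute)
    obtain M W' where M: "M \<subseteq> E" "disjoint M" "W' \<subseteq> W - \<Union>M"
      and waste: "B * card (W - \<Union>M - W') \<le> card W + J * \<kappa> * card W"
      and left: "card W' \<le> exp (- \<epsilon>) ^ J * card W + J * \<kappa> * card W"
      using nibble[OF H order_refl dev D(2) cD] by blast
    have "B * card (W - \<Union>M - W') \<le> card W + 1 * real (card W)"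
      using waste CJ unfolding J\<kappa> by (elim order_trans) (intro add_mono mult_right_mono, auto)
    then have 1: "card (W - \<Union>M - W') \<le> \<delta> / 2 * card W"
      using \<delta> by (simp add: B_def field_simps)
    have 2: "card W' \<le> \<delta> / 4 * card W + \<delta> / 4 * card W"
      using left CJ L unfolding J\<kappa> uJ by (elim order_trans) (intro add_mono mult_right_mono, auto)
    have "W - \<Union>M = (W - \<Union>M - W') \<union> W'" using M(3) by auto
    then have "card (W - \<Union>M) \<le> card (W - \<Union>M - W') + card W'" by (metis card_Un_le)
    then have "card (W - \<Union>M) \<le> \<delta> * card W" using 1 2 by (simp add: field_simps)
    then show "\<exists>M\<subseteq>E. disjoint M \<and> card (W - \<Union>M) \<le> \<delta> * card W" using M by blast
  qed
qed

section \<open>Systems of orbits on a large point set\<close>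

text \<open>What is kept of a cyclic design without short orbits: \<open>cls i\<close> is the set of
  blocks of orbit i, and two points determine a block. The group is forgotten; only counts are used
  from here on.\<close>

locale orbit_system =
  fixes V :: "'a set" and I :: "'i set" and cls :: "'i \<Rightarrow> 'a set set" and v k :: nat
  assumes k: "3 \<le> k" and finV: "finite V" and cardV: "card V = v" and v: "0 < v" and finI: "finite I"
    and cls: "\<And>i B. i \<in> I \<Longrightarrow> B \<in> cls i \<Longrightarrow> B \<subseteq> V \<and> card B = k"
    and card_cls: "\<And>i. i \<in> I \<Longrightarrow> card (cls i) = v"
    and point_degree: "\<And>i x. i \<in> I \<Longrightarrow> x \<in> V \<Longrightarrow> card {B \<in> cls i. x \<in> B} = k"
    and cover: "\<And>x y. x \<in> V \<Longrightarrow> y \<in> V \<Longrightarrow> x \<noteq> y \<Longrightarrow> \<exists>i\<in>I. \<exists>B\<in>cls i. x \<in> B \<and> y \<in> B"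
    and unique: "\<And>i j B C x y. i \<in> I \<Longrightarrow> j \<in> I \<Longrightarrow> B \<in> cls i \<Longrightarrow> C \<in> cls j \<Longrightarrow>
      x \<noteq> y \<Longrightarrow> x \<in> B \<Longrightarrow> y \<in> B \<Longrightarrow> x \<in> C \<Longrightarrow> y \<in> C \<Longrightarrow> i = j \<and> B = C"
begin

lemma finite_cls: "i \<in> I \<Longrightarrow> finite (cls i)"
  using card_cls[of i] v card_ge_0_finite[of "cls i"] by simp

lemma finite_block: "i \<in> I \<Longrightarrow> B \<in> cls i \<Longrightarrow> finite B"
  using cls[of i B] finite_subset[OF _ finV] by simp

text \<open>A fixed point x lies in k blocks of each orbit, and these blocks split the other v - 1
  points into sets of size k - 1.\<close>

lemma card_I: "card I * (k * (k - 1)) = v - 1"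
proof -
  have "V \<noteq> {}" using v cardV by auto
  then obtain x where x: "x \<in> V" by blast
  define P where "P = (SIGMA i:I. {B \<in> cls i. x \<in> B})"
  have finP: "finite P" unfolding P_def using finI finite_cls by auto
  have "card P = (\<Sum>i\<in>I. k)"
    unfolding P_def using finI finite_cls x by (subst card_SigmaI) (auto simp: point_degree)
  then have cardP: "card P = card I * k" by simp
  have "V - {x} = (\<Union>z\<in>P. snd z - {x})"
  proof
    show "V - {x} \<subseteq> (\<Union>z\<in>P. snd z - {x})"
    proof
      fix y assume y: "y \<in> V - {x}"
      then obtain i B where "i \<in> I" "B \<in> cls i" "x \<in> B" "y \<in> B" using cover[of x y] x by auto
      then have "(i, B) \<in> P" "y \<in> snd (i, B) - {x}" using y by (auto simp: P_def)
      then show "y \<in> (\<Union>z\<in>P. snd z - {x})" by blast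
    qed
    show "(\<Union>z\<in>P. snd z - {x}) \<subseteq> V - {x}"
    proof
      fix y assume "y \<in> (\<Union>z\<in>P. snd z - {x})"
      then obtain i B where "i \<in> I" "B \<in> cls i" "y \<in> B" "y \<noteq> x" by (auto simp: P_def)
      then show "y \<in> V - {x}" using cls[of i B] by auto
    qed
  qed
  then have "card (V - {x}) = card (\<Union>z\<in>P. snd z - {x})" by simp
  also have "\<dots> = (\<Sum>z\<in>P. card (snd z - {x}))"
  proof (rule card_UN_disjoint[OF finP])
    show "\<forall>z\<in>P. finite (snd z - {x})" using finite_block unfolding P_def by auto
    show "\<forall>z\<in>P. \<forall>w\<in>P. z \<noteq> w \<longrightarrow> (snd z - {x}) \<inter> (snd w - {x}) = {}"
    proof (intro ballI impI, rule ccontr)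
      fix z w assume zw: "z \<in> P" "w \<in> P" "z \<noteq> w" "(snd z - {x}) \<inter> (snd w - {x}) \<noteq> {}"
      from zw(4) obtain y where y: "y \<in> snd z" "y \<in> snd w" "x \<noteq> y" by blast
      have in_P: "fst u \<in> I" "snd u \<in> cls (fst u)" "x \<in> snd u" if "u \<in> P" for u
        using that unfolding P_def by auto
      have "fst z = fst w \<and> snd z = snd w"
        by (rule unique[OF in_P(1)[OF zw(1)] in_P(1)[OF zw(2)] in_P(2)[OF zw(1)] in_P(2)[OF zw(2)]
              y(3) in_P(3)[OF zw(1)] y(1) in_P(3)[OF zw(2)] y(2)])
      then show False using zw(3) by (simp add: prod_eq_iff)
    qed
  qed
  also have "\<dots> = (\<Sum>z\<in>P. k - 1)"
  proof (rule sum.cong[OF refl])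
    fix z assume "z \<in> P"
    then have "fst z \<in> I" "snd z \<in> cls (fst z)" "x \<in> snd z" unfolding P_def by auto
    then show "card (snd z - {x}) = k - 1" using cls[of "fst z" "snd z"] finite_block[of "fst z" "snd z"] by simp
  qed
  also have "\<dots> = card I * (k * (k - 1))" by (simp add: cardP)
  finally show ?thesis using x cardV finV by simp
qed

lemma card_hitting:
  assumes "i \<in> I" "X \<subseteq> V"
  shows "card {B \<in> cls i. B \<inter> X \<noteq> {}} \<le> k * card X"
proof -
  have finX: "finite X" using assms finV finite_subset by blast
  have "{B \<in> cls i. B \<inter> X \<noteq> {}} = (\<Union>x\<in>X. {B \<in> cls i. x \<in> B})" by auto
  also have "card \<dots> \<le> (\<Sum>x\<in>X. card {B \<in> cls i. x \<in> B})" by (rule card_UN_le[OF finX])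
  also have "\<dots> = (\<Sum>x\<in>X. k)" using assms point_degree by (intro sum.cong) auto
  finally show ?thesis by (simp add: mult.commute)
qed

lemma card_Union_choice:
  assumes "S \<subseteq> I" "\<And>i. i \<in> S \<Longrightarrow> T i \<in> cls i"
  shows "(\<Union>i\<in>S. T i) \<subseteq> V" "card (\<Union>i\<in>S. T i) \<le> k * card S"
proof -
  have finS: "finite S" using assms finI finite_subset by blast
  show "(\<Union>i\<in>S. T i) \<subseteq> V" using assms cls by blast
  have "card (\<Union>i\<in>S. T i) \<le> (\<Sum>i\<in>S. card (T i))" by (rule card_UN_le[OF finS])
  also have "\<dots> = (\<Sum>i\<in>S. k)" using assms cls by (intro sum.cong) auto
  finally show "card (\<Union>i\<in>S. T i) \<le> k * card S" by (simp add: mult.commute)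
qed

definition choice where
  "choice S T \<longleftrightarrow> (\<forall>i\<in>S. T i \<in> cls i) \<and> (\<forall>i\<in>S. \<forall>j\<in>S. i \<noteq> j \<longrightarrow> T i \<inter> T j = {})"

lemma choice_insert:
  assumes T: "choice S T" and i: "i \<notin> S" and B: "B \<in> cls i" "B \<inter> (\<Union>j\<in>S. T j) = {}"
  shows "choice (insert i S) (T(i := B))"
  unfolding choice_def
proof (intro conjI ballI impI)
  fix j assume "j \<in> insert i S"
  then show "(T(i := B)) j \<in> cls j" using T B unfolding choice_def by (cases "j = i") auto
next
  fix j l assume jl: "j \<in> insert i S" "l \<in> insert i S" "j \<noteq> l"
  have BT: "B \<inter> T j = {}" if "j \<in> S" for j using B(2) that by blast
  show "(T(i := B)) j \<inter> (T(i := B)) l = {}"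
  proof (cases "j = i \<or> l = i")
    case True
    then show ?thesis using BT[of j] BT[of l] jl by (auto simp: Int_commute)
  next
    case False
    then show ?thesis using T jl unfolding choice_def by simp
  qed
qed

end

section \<open>Greedy repair from two blocks per orbit\<close>

lemma card_disjoint_hit:
  assumes "finite Y" "\<And>i j. i \<in> P \<Longrightarrow> j \<in> P \<Longrightarrow> i \<noteq> j \<Longrightarrow> U i \<inter> U j = {}"
  shows "finite {i \<in> P. U i \<inter> Y \<noteq> {}}" "card {i \<in> P. U i \<inter> Y \<noteq> {}} \<le> card Y"
proof -
  let ?H = "{i \<in> P. U i \<inter> Y \<noteq> {}}"
  have "\<forall>i\<in>?H. \<exists>y. y \<in> U i \<inter> Y" by blast
  from bchoice[OF this] obtain g where g: "\<forall>i\<in>?H. g i \<in> U i \<inter> Y" ..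
  have inj: "inj_on g ?H"
  proof (rule inj_onI, rule ccontr)
    fix i j assume i: "i \<in> ?H" and j: "j \<in> ?H" and eq: "g i = g j" and "i \<noteq> j"
    then have "U i \<inter> U j = {}" by (intro assms(2)) simp_all
    moreover have "g i \<in> U i" "g j \<in> U j" using g i j by blast+
    ultimately show False using eq by auto
  qed
  have img: "g ` ?H \<subseteq> Y" using g by blast
  show "finite ?H" using inj img assms(1) by (rule inj_on_finite)
  show "card ?H \<le> card Y" using inj img assms(1) by (rule card_inj_on_le)
qed

lemma finite_greedy:
  assumes "finite L" "Q {} T0"
    and "\<And>S T i. S \<subseteq> L \<Longrightarrow> i \<in> L - S \<Longrightarrow> Q S T \<Longrightarrow> \<exists>B. Q (insert i S) (T(i := B))"
  shows "\<exists>T. Q L T"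
proof -
  have "S \<subseteq> L \<Longrightarrow> \<exists>T. Q S T" if "finite S" for S
    using that
  proof (induction S rule: finite_induct)
    case empty
    show ?case by (rule exI[of "Q {}", OF assms(2)])
  next
    case (insert i S)
    then have sub: "S \<subseteq> L" "i \<in> L - S" by auto
    obtain T where "Q S T" using insert.IH[OF sub(1)] by (rule exE)
    from assms(3)[OF sub this] obtain B where "Q (insert i S) (T(i := B))" by (rule exE)
    then show ?case by (rule exI[of "Q (insert i S)"])
  qed
  from this[OF assms(1) order_refl] show ?thesis .
qed

text \<open>In \<open>room\<close>, 12 bounds the number of very bad orbits, 12 k the number of slot
  pairs hit by their blocks, and \<open>I - P\<close> has no slots; call the sum n'. Serving these
  orbits forbids at most k n' points of chosen blocks and 2 k points in each of at most k n' slot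
  pairs hit. A forbidden point excludes k blocks of an orbit, so fewer than v / 2 blocks are
  excluded, and the other half of the orbit absorbs the bad ones.\<close>

locale two_slots = orbit_system V I cls v k
  for V :: "'a set" and I :: "'i set" and cls :: "'i \<Rightarrow> 'a set set" and v k :: nat +
  fixes P :: "'i set" and s :: "'i \<Rightarrow> bool \<Rightarrow> 'a set"
  assumes P: "P \<subseteq> I"
    and slot: "\<And>i b. i \<in> P \<Longrightarrow> s i b \<in> cls i"
    and slot_disjoint: "\<And>i j b c. i \<in> P \<Longrightarrow> j \<in> P \<Longrightarrow> (i, b) \<noteq> (j, c) \<Longrightarrow> s i b \<inter> s j c = {}"
    and room: "2 * (k * k + 2 * k * k * k) * (card (I - P) + 12 * k + 12) < v"
begin

definition "U i = s i True \<union> s i False"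

lemma U_disjoint: "i \<in> P \<Longrightarrow> j \<in> P \<Longrightarrow> i \<noteq> j \<Longrightarrow> U i \<inter> U j = {}"
  unfolding U_def using slot_disjoint[of i j] by auto

lemma U: "i \<in> P \<Longrightarrow> U i \<subseteq> V \<and> finite (U i) \<and> card (U i) \<le> 2 * k"
proof -
  assume i: "i \<in> P"
  have iI: "i \<in> I" using P i by blast
  have s: "s i b \<subseteq> V \<and> card (s i b) = k" for b by (rule cls[OF iI slot[OF i]])
  have "card (U i) \<le> card (s i True) + card (s i False)" unfolding U_def by (rule card_Un_le)
  moreover have sub: "U i \<subseteq> V" using s unfolding U_def by blast
  moreover have "finite (U i)" using sub finV by (rule finite_subset)
  ultimately show ?thesis using s by simp
qed

lemmas card_hit_slots = card_disjoint_hit[where U = U and P = P, OF _ U_disjoint]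

text \<open>A bad block could damage both slots of some orbit. Since two points determine a block, there are few
  bad blocks in total, hence only boundedly many orbits that have many of them; these are served first.\<close>

definition "bad i = {B \<in> cls i. \<exists>j\<in>P. \<not> card (B \<inter> U j) \<le> 1}"
definition "very_bad = {i \<in> I. v \<le> 2 * card (bad i)}"

text \<open>A bad block contains two points of some \<open>U j\<close>, and two points determine a
  block together with its orbit. Picking such a pair is therefore injective, and there are at most
  (2 k)^2 pairs for each j.\<close>

lemma sum_bad: "(\<Sum>i\<in>I. card (bad i)) \<le> card I * (4 * k * k)"
proof -
  let ?Z = "SIGMA i:I. bad i"
  let ?R = "\<lambda>z w. fst w \<noteq> snd w \<and> fst w \<in> snd z \<and> snd w \<in> snd z \<and> (\<exists>j\<in>P. fst w \<in> U j \<and> snd w \<in> U j)"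
  have ex: "\<exists>w. ?R z w" if "z \<in> ?Z" for z
  proof -
    have "snd z \<in> bad (fst z)" using that by auto
    then obtain j where j: "j \<in> P" "\<not> card (snd z \<inter> U j) \<le> 1" unfolding bad_def by blast
    have "finite (snd z \<inter> U j)" using U[OF j(1)] by auto
    then obtain x y where "x \<in> snd z \<inter> U j" "y \<in> snd z \<inter> U j" "x \<noteq> y"
      using j(2) card_le_Suc0_iff_eq[of "snd z \<inter> U j"] by auto
    then show ?thesis using j(1) by (intro exI[of _ "(x, y)"]) auto
  qed
  let ?g = "\<lambda>z. SOME w. ?R z w"
  have g: "?R z (?g z)" if "z \<in> ?Z" for z using someI_ex[OF ex[OF that]] .
  have inj: "inj_on ?g ?Z"
  proof (rule inj_onI)
    fix z z' assume z: "z \<in> ?Z" and z': "z' \<in> ?Z" and eq: "?g z = ?g z'"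
    define w where "w = ?g z"
    have R: "?R z w" using g[OF z] unfolding w_def .
    have R': "?R z' w" using g[OF z'] unfolding w_def eq .
    have in_Z: "fst u \<in> I" "snd u \<in> cls (fst u)" if "u \<in> ?Z" for u
      using that unfolding bad_def by auto
    have xy: "fst w \<noteq> snd w" "fst w \<in> snd z" "snd w \<in> snd z" "fst w \<in> snd z'" "snd w \<in> snd z'"
      using R R' by simp_all
    have "fst z = fst z' \<and> snd z = snd z'"
      by (rule unique[OF in_Z(1)[OF z] in_Z(1)[OF z'] in_Z(2)[OF z] in_Z(2)[OF z'] xy])
    then show "z = z'" by (simp add: prod_eq_iff)
  qed
  have finP: "finite P" using P finI finite_subset by blast
  have img: "?g ` ?Z \<subseteq> (\<Union>j\<in>P. U j \<times> U j)"
  proof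
    fix w assume "w \<in> ?g ` ?Z"
    then obtain z where z: "z \<in> ?Z" "w = ?g z" by blast
    have "?R z w" unfolding z(2) by (rule g[OF z(1)])
    then obtain j where "j \<in> P" "fst w \<in> U j" "snd w \<in> U j" by blast
    then show "w \<in> (\<Union>j\<in>P. U j \<times> U j)" by (auto simp: mem_Times_iff)
  qed
  have "(\<Sum>i\<in>I. card (bad i)) = card ?Z"
    using finI finite_cls by (subst card_SigmaI) (auto simp: bad_def)
  also have "\<dots> \<le> card (\<Union>j\<in>P. U j \<times> U j)"
    using inj img finP U by (intro card_inj_on_le) auto
  also have "\<dots> \<le> (\<Sum>j\<in>P. card (U j \<times> U j))" by (rule card_UN_le[OF finP])
  also have "\<dots> \<le> (\<Sum>j\<in>P. (2 * k) * (2 * k))"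
    unfolding card_cartesian_product using U by (intro sum_mono mult_mono) auto
  also have "\<dots> \<le> card I * (4 * k * k)" using card_mono[OF finI P] by simp
  finally show ?thesis .
qed

text \<open>Each very bad orbit has at least v / 2 of the at most 4 k^2 |I| bad blocks. Since k >= 3
  gives 8 k^2 <= 12 k (k - 1), and |I| k (k - 1) = v - 1, there are at most 12.\<close>

lemma card_very_bad: "card very_bad \<le> 12"
proof -
  have "card very_bad * v = (\<Sum>i\<in>very_bad. v)" by simp
  also have "\<dots> \<le> (\<Sum>i\<in>very_bad. 2 * card (bad i))"
    unfolding very_bad_def by (intro sum_mono) auto
  also have "\<dots> \<le> (\<Sum>i\<in>I. 2 * card (bad i))"
    using finI unfolding very_bad_def by (intro sum_mono2) auto
  also have "\<dots> \<le> 2 * (card I * (4 * k * k))" using sum_bad by (simp add: sum_distrib_left[symmetric] mult_ac)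
  also have "\<dots> \<le> 12 * (card I * (k * (k - 1)))"
  proof -
    have "k * 3 \<le> k * k" using k by simp
    then have "8 * (k * k) \<le> 12 * (k * k) - 12 * k" by linarith
    also have "\<dots> = 12 * (k * (k - 1))" by (simp add: right_diff_distrib')
    finally have "8 * (k * k) \<le> 12 * (k * (k - 1))" .
    then have "card I * (8 * (k * k)) \<le> card I * (12 * (k * (k - 1)))" by (rule mult_le_mono2)
    then show ?thesis by (simp add: mult_ac)
  qed
  also have "\<dots> \<le> 12 * v" using card_I by simp
  finally show ?thesis using v by simp
qed

lemma disjoint_representatives:
  "\<exists>f. (\<forall>i\<in>I. f i \<in> cls i) \<and> (\<forall>i\<in>I. \<forall>j\<in>I. i \<noteq> j \<longrightarrow> f i \<inter> f j = {})"
proof -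
  define c where "c = k * k + 2 * k * k * k"
  have room': "2 * c * (card (I - P) + 12 * k + 12) < v" using room unfolding c_def .
  let ?VB = very_bad
  have VB: "?VB \<subseteq> I" unfolding very_bad_def by auto
  have finVB: "finite ?VB" using VB finI finite_subset by blast
  have "\<exists>T. choice ?VB T"
  proof (rule finite_greedy[OF finVB])
    show "choice {} (\<lambda>_. {})" by (simp add: choice_def)
    fix S T i assume S: "S \<subseteq> ?VB" and i: "i \<in> ?VB - S" and T: "choice S T"
    let ?X = "\<Union>j\<in>S. T j"
    have SI: "S \<subseteq> I" "i \<in> I" using S i VB by auto
    have X: "?X \<subseteq> V" "card ?X \<le> k * card S" using card_Union_choice[OF SI(1)] T by (auto simp: choice_def)
    have "card {B \<in> cls i. B \<inter> ?X \<noteq> {}} \<le> k * card ?X" by (rule card_hitting[OF SI(2) X(1)])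
    also have "\<dots> \<le> k * (k * 12)"
    proof (rule mult_le_mono2)
      have "k * card S \<le> k * 12" using card_mono[OF finVB S] card_very_bad by (intro mult_le_mono2) simp
      with X(2) show "card ?X \<le> k * 12" by (rule le_trans)
    qed
    also have "\<dots> \<le> 2 * c * (card (I - P) + 12 * k + 12)"
      unfolding c_def by (simp add: algebra_simps)
    also have "\<dots> < v" by (rule room')
    finally have "card {B \<in> cls i. B \<inter> ?X \<noteq> {}} < card (cls i)" using card_cls SI by simp
    then have "{B \<in> cls i. B \<inter> ?X \<noteq> {}} \<noteq> cls i" by (metis less_irrefl)
    then obtain B where B: "B \<in> cls i" "B \<inter> ?X = {}" by blast
    have "choice (insert i S) (T(i := B))"
      using choice_insert[OF T _ B] i by simp
    then show "\<exists>B. choice (insert i S) (T(i := B))" ..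
  qed
  then obtain T1 where T1: "choice ?VB T1" by blast
  let ?Y = "\<Union>j\<in>?VB. T1 j"
  have Y: "?Y \<subseteq> V" "card ?Y \<le> k * card ?VB" using card_Union_choice[OF VB] T1 by (auto simp: choice_def)
  have finY: "finite ?Y" using Y(1) finV finite_subset by blast
  \<comment> \<open>Orbits of \<open>P1\<close> wait until the end and then take one of their slots.
    An orbit whose slots were hit by the block of a very bad orbit is served in \<open>L\<close>,
    together with those that never had slots.\<close>
  define P1 where "P1 = {i \<in> P - ?VB. U i \<inter> ?Y = {}}"
  define L where "L = I - ?VB - P1"
  have finL: "finite L" using finI by (simp add: L_def)
  have cardL: "card L \<le> card (I - P) + 12 * k"
  proof -
    have "L \<subseteq> (I - P) \<union> {i \<in> P. U i \<inter> ?Y \<noteq> {}}" unfolding L_def P1_def by auto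
    then have "card L \<le> card ((I - P) \<union> {i \<in> P. U i \<inter> ?Y \<noteq> {}})"
      using finI card_hit_slots(1)[OF finY] by (intro card_mono) auto
    also have "\<dots> \<le> card (I - P) + card {i \<in> P. U i \<inter> ?Y \<noteq> {}}" by (rule card_Un_le)
    also have "card {i \<in> P. U i \<inter> ?Y \<noteq> {}} \<le> card ?Y" by (rule card_hit_slots(2)[OF finY])
    also have "\<dots> \<le> k * card ?VB" by (rule Y(2))
    also have "\<dots> \<le> k * 12" using card_very_bad by (rule mult_le_mono2)
    finally show ?thesis by simp
  qed
  \<comment> \<open>The last two conditions say that no two new blocks hit the same pair of slots
    and that no new block hits it in two points. Damage to both slots of an orbit would violate one
    of them.\<close>
  define Q2 where "Q2 S T \<longleftrightarrow> choice (?VB \<union> S) T \<and> (\<forall>i\<in>?VB. T i = T1 i) \<and>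
    (\<forall>i\<in>P. \<forall>j\<in>S. \<forall>l\<in>S. T j \<inter> U i \<noteq> {} \<longrightarrow> T l \<inter> U i \<noteq> {} \<longrightarrow> j = l) \<and>
    (\<forall>i\<in>P. \<forall>j\<in>S. card (T j \<inter> U i) \<le> 1)" for S and T :: "'i \<Rightarrow> 'a set"
  have "\<exists>T. Q2 L T"
  proof (rule finite_greedy[OF finL])
    show "Q2 {} T1" using T1 by (simp add: Q2_def)
    fix S T i assume S: "S \<subseteq> L" and i: "i \<in> L - S" and T: "Q2 S T"
    have SI: "S \<subseteq> I" "?VB \<union> S \<subseteq> I" "i \<in> I" "i \<notin> ?VB" using S i VB by (auto simp: L_def)
    let ?X1 = "\<Union>j\<in>?VB \<union> S. T j" and ?X2 = "\<Union>j\<in>S. T j"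
    let ?H = "{j \<in> P. U j \<inter> ?X2 \<noteq> {}}"
    \<comment> \<open>Besides the used points, a new block avoids every pair of slots already hit.
      That it hits an intact pair at most once will follow from its not being bad.\<close>
    let ?X = "?X1 \<union> (\<Union>j\<in>?H. U j)"
    have cardS: "card S \<le> card (I - P) + 12 * k" using card_mono[OF finL S] cardL by simp
    have Tc: "T j \<in> cls j" if "j \<in> ?VB \<union> S" for j using T that unfolding choice_def Q2_def by blast
    have X1: "?X1 \<subseteq> V" "card ?X1 \<le> k * card (?VB \<union> S)" using card_Union_choice[OF SI(2) Tc] by blast+
    have X2: "?X2 \<subseteq> V" "card ?X2 \<le> k * card S" using card_Union_choice[OF SI(1), of T] Tc by blast+
    have finX2: "finite ?X2" using X2(1) finV finite_subset by blast
    have H: "finite ?H" "card ?H \<le> k * card S"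
      using card_hit_slots[OF finX2] X2(2) by (blast intro: le_trans)+
    have XV: "?X \<subseteq> V" using X1 U by blast
    let ?n = "card (I - P) + 12 * k + 12"
    have cardX: "card ?X \<le> k * ?n + 2 * k * k * ?n"
    proof -
      have "card ?X \<le> card ?X1 + card (\<Union>j\<in>?H. U j)" by (rule card_Un_le)
      also have "card (\<Union>j\<in>?H. U j) \<le> (\<Sum>j\<in>?H. card (U j))" by (rule card_UN_le[OF H(1)])
      also have "\<dots> \<le> (\<Sum>j\<in>?H. 2 * k)" using U by (intro sum_mono) auto
      also have "\<dots> = 2 * k * card ?H" by simp
      also have "\<dots> \<le> 2 * k * (k * ?n)"
      proof (rule mult_le_mono2)
        have "k * card S \<le> k * ?n" using cardS by (intro mult_le_mono2) simp
        with H(2) show "card ?H \<le> k * ?n" by (rule le_trans)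
      qed
      also have "card ?X1 \<le> k * ?n"
      proof -
        have "card (?VB \<union> S) \<le> 12 + (card (I - P) + 12 * k)"
          using card_Un_le[of ?VB S] cardS card_very_bad by linarith
        then have "k * card (?VB \<union> S) \<le> k * ?n" by (intro mult_le_mono2) simp
        with X1(2) show ?thesis by (rule le_trans)
      qed
      finally show ?thesis by (simp add: mult.assoc)
    qed
    have "card ({B \<in> cls i. B \<inter> ?X \<noteq> {}} \<union> bad i) \<le> card {B \<in> cls i. B \<inter> ?X \<noteq> {}} + card (bad i)"
      by (rule card_Un_le)
    also have "card {B \<in> cls i. B \<inter> ?X \<noteq> {}} \<le> k * card ?X" by (rule card_hitting[OF SI(3) XV])
    also have "k * card ?X \<le> k * (k * ?n + 2 * k * k * ?n)" using cardX by (rule mult_le_mono2)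
    also have "\<dots> = c * ?n" unfolding c_def by (simp add: algebra_simps)
    finally have "2 * card ({B \<in> cls i. B \<inter> ?X \<noteq> {}} \<union> bad i) \<le> 2 * c * ?n + 2 * card (bad i)" by simp
    also have "\<dots> < v + v"
      using room' SI(3,4) unfolding very_bad_def by (intro add_strict_mono) auto
    finally have "card ({B \<in> cls i. B \<inter> ?X \<noteq> {}} \<union> bad i) < card (cls i)" using card_cls SI by simp
    then have "\<not> cls i \<subseteq> {B \<in> cls i. B \<inter> ?X \<noteq> {}} \<union> bad i"
      using card_mono[of "{B \<in> cls i. B \<inter> ?X \<noteq> {}} \<union> bad i" "cls i"] finite_cls[OF SI(3)] by (auto simp: bad_def)
    then obtain B where B: "B \<in> cls i" "B \<inter> ?X = {}" "B \<notin> bad i" by blast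
    have small: "card (B \<inter> U j) \<le> 1" if "j \<in> P" for j using B(1,3) that by (auto simp: bad_def)
    have touched: "B \<inter> U j = {}" if "j \<in> P" "l \<in> S" "T l \<inter> U j \<noteq> {}" for j l
    proof -
      have "j \<in> ?H" using that by blast
      then show ?thesis using B(2) by blast
    qed
    have T': "choice (?VB \<union> S) T" "\<forall>j\<in>?VB. T j = T1 j"
      "\<And>j l m. j \<in> P \<Longrightarrow> l \<in> S \<Longrightarrow> m \<in> S \<Longrightarrow> T l \<inter> U j \<noteq> {} \<Longrightarrow> T m \<inter> U j \<noteq> {} \<Longrightarrow> l = m"
      "\<And>j l. j \<in> P \<Longrightarrow> l \<in> S \<Longrightarrow> card (T l \<inter> U j) \<le> 1"
      using T unfolding Q2_def by blast+
    have i': "i \<notin> S" "i \<notin> ?VB" using i SI by auto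
    have "Q2 (insert i S) (T(i := B))"
      unfolding Q2_def
    proof (intro conjI)
      have "B \<inter> (\<Union>j\<in>?VB \<union> S. T j) = {}" using B(2) by blast
      from choice_insert[OF T'(1) _ B(1) this] i' show "choice (?VB \<union> insert i S) (T(i := B))" by simp
      show "\<forall>j\<in>?VB. (T(i := B)) j = T1 j" using T'(2) i' by auto
      show "\<forall>j\<in>P. \<forall>l\<in>insert i S. \<forall>m\<in>insert i S. (T(i := B)) l \<inter> U j \<noteq> {} \<longrightarrow> (T(i := B)) m \<inter> U j \<noteq> {} \<longrightarrow> l = m"
      proof (intro ballI impI)
        fix j l m assume a: "j \<in> P" "l \<in> insert i S" "m \<in> insert i S" "(T(i := B)) l \<inter> U j \<noteq> {}" "(T(i := B)) m \<inter> U j \<noteq> {}"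
        show "l = m"
          using touched[of j l] touched[of j m] T'(3)[of j l m] a i' by (cases "l = i"; cases "m = i") auto
      qed
      show "\<forall>j\<in>P. \<forall>l\<in>insert i S. card ((T(i := B)) l \<inter> U j) \<le> 1"
        using T'(4) small by auto
    qed
    then show "\<exists>B. Q2 (insert i S) (T(i := B))" ..
  qed
  then obtain T where TQ: "Q2 L T" by blast
  have T: "choice (?VB \<union> L) T" "\<And>i. i \<in> ?VB \<Longrightarrow> T i = T1 i"
    "\<And>i j l. i \<in> P \<Longrightarrow> j \<in> L \<Longrightarrow> l \<in> L \<Longrightarrow> T j \<inter> U i \<noteq> {} \<Longrightarrow> T l \<inter> U i \<noteq> {} \<Longrightarrow> j = l"
    "\<And>i j. i \<in> P \<Longrightarrow> j \<in> L \<Longrightarrow> card (T j \<inter> U i) \<le> 1"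
    using TQ unfolding Q2_def by blast+
  have P1P: "P1 \<subseteq> P" by (auto simp: P1_def)
  have "\<exists>b. \<forall>j\<in>?VB \<union> L. s i b \<inter> T j = {}" if i: "i \<in> P1" for i
  proof (rule ccontr)
    assume no: "\<not> ?thesis"
    have iP: "i \<in> P" using i P1P by auto
    have VBfree: "s i b \<inter> T j = {}" if "j \<in> ?VB" for j b
    proof -
      have "s i b \<subseteq> U i" by (cases b) (auto simp: U_def)
      then show ?thesis using i that T(2) unfolding P1_def by blast
    qed
    have ex: "\<exists>j\<in>L. s i b \<inter> T j \<noteq> {}" for b
    proof -
      obtain j where "j \<in> ?VB \<union> L" "s i b \<inter> T j \<noteq> {}" using no by blast
      then show ?thesis using VBfree[of j b] by blast
    qed
    obtain j where j: "j \<in> L" "s i True \<inter> T j \<noteq> {}" using ex[of True] by blast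
    obtain l where l: "l \<in> L" "s i False \<inter> T l \<noteq> {}" using ex[of False] by blast
    have "T j \<inter> U i \<noteq> {}" "T l \<inter> U i \<noteq> {}" using j(2) l(2) unfolding U_def by blast+
    then have jl: "j = l" by (rule T(3)[OF iP j(1) l(1)])
    obtain x y where xy: "x \<in> s i True \<inter> T j" "y \<in> s i False \<inter> T j" using j l jl by blast
    have "x \<noteq> y" using slot_disjoint[OF iP iP, of True False] xy by auto
    moreover have "x \<in> T j \<inter> U i" "y \<in> T j \<inter> U i" using xy unfolding U_def by auto
    moreover have "finite (T j \<inter> U i)" using U[OF iP] by auto
    ultimately show False using T(4)[OF iP j(1)] card_le_Suc0_iff_eq[of "T j \<inter> U i"] by auto
  qed
  then have "\<forall>i\<in>P1. \<exists>b. \<forall>j\<in>?VB \<union> L. s i b \<inter> T j = {}" by blast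
  from bchoice[OF this] obtain b where "\<forall>i\<in>P1. \<forall>j\<in>?VB \<union> L. s i (b i) \<inter> T j = {}" ..
  then have b: "s i (b i) \<inter> T j = {}" if "i \<in> P1" "j \<in> ?VB \<union> L" for i j using that by blast
  define f where "f i = (if i \<in> P1 then s i (b i) else T i)" for i
  have I: "i \<in> ?VB \<union> L" if "i \<in> I" "i \<notin> P1" for i using that by (auto simp: L_def)
  show ?thesis
  proof (intro exI[of _ f] conjI ballI impI)
    fix i assume i: "i \<in> I"
    show "f i \<in> cls i"
    proof (cases "i \<in> P1")
      case True
      then show ?thesis using slot[of i "b i"] P1P by (auto simp: f_def)
    next
      case False
      then show ?thesis using T(1) I[OF i False] unfolding f_def choice_def by simp
    qed
  next
    fix i j assume ij: "i \<in> I" "j \<in> I" "i \<noteq> j"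
    show "f i \<inter> f j = {}"
    proof (cases "i \<in> P1"; cases "j \<in> P1")
      assume "i \<in> P1" "j \<in> P1"
      then show ?thesis using slot_disjoint[of i j "b i" "b j"] P1P ij by (auto simp: f_def)
    next
      assume "i \<in> P1" "j \<notin> P1"
      then show ?thesis using b[of i j] I[of j] ij by (simp add: f_def)
    next
      assume "i \<notin> P1" "j \<in> P1"
      then show ?thesis using b[of j i] I[of i] ij by (simp add: f_def Int_commute)
    next
      assume "i \<notin> P1" "j \<notin> P1"
      then show ?thesis using T(1) I[of i] I[of j] ij unfolding choice_def f_def by simp
    qed
  qed
qed

end

section \<open>The hypergraph of orbit copies and points\<close>

context orbit_system begin

definition copy_edge :: "'i \<times> nat \<times> 'a set \<Rightarrow> ('i \<times> nat + 'a) set" where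
  "copy_edge z = insert (Inl (fst z, fst (snd z))) (Inr ` snd (snd z))"

text \<open>The number k - 1 balances the degrees: a copy lies in v edges, a point in k (k - 1) |I|
  = v - 1. By k >= 3 there are at least two copies to supply the two slots.\<close>

definition "copies = (SIGMA i:I. {..<k - 1} \<times> cls i)"

definition "copy_vertices = Inl ` (I \<times> {..<k - 1}) \<union> Inr ` V"

lemma Inl_copy_edge: "Inl (i, c) \<in> copy_edge z \<longleftrightarrow> i = fst z \<and> c = fst (snd z)"
  by (auto simp: copy_edge_def)

lemma Inr_copy_edge: "Inr x \<in> copy_edge z \<longleftrightarrow> x \<in> snd (snd z)"
  by (auto simp: copy_edge_def)

lemma inj_copy_edge: "inj copy_edge"
proof (rule injI)
  fix z w assume eq: "copy_edge z = copy_edge w"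
  have "fst z = fst w" "fst (snd z) = fst (snd w)"
    using Inl_copy_edge[of "fst z" "fst (snd z)" z] Inl_copy_edge[of "fst z" "fst (snd z)" w] eq by simp_all
  moreover have "snd (snd z) = snd (snd w)"
    using Inr_copy_edge[of _ z] Inr_copy_edge[of _ w] eq by (intro set_eqI) simp
  ultimately show "z = w" by (simp add: prod_eq_iff)
qed

lemma card_copy_edges: "card {e \<in> copy_edge ` copies. Q e} = card {z \<in> copies. Q (copy_edge z)}"
  unfolding Compr_image_eq by (rule card_image[OF inj_on_subset[OF inj_copy_edge subset_UNIV]])

lemma copy_edge_uniform:
  assumes "e \<in> copy_edge ` copies"
  shows "e \<subseteq> copy_vertices \<and> card e = k + 1"
proof -
  obtain z where z: "z \<in> copies" "e = copy_edge z" using assms by (rule imageE)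
  have I: "fst z \<in> I" "fst (snd z) < k - 1" "snd (snd z) \<in> cls (fst z)"
    using z(1) unfolding copies_def by auto
  have B: "snd (snd z) \<subseteq> V" "card (snd (snd z)) = k" "finite (snd (snd z))"
    using cls[OF I(1,3)] finite_block[OF I(1,3)] by auto
  have "e \<subseteq> copy_vertices" unfolding z(2) copy_edge_def copy_vertices_def using I B(1) by auto
  moreover have "card e = Suc (card (Inr ` snd (snd z) :: ('i \<times> nat + 'a) set))"
    unfolding z(2) copy_edge_def using B(3) by (intro card_insert_disjoint) auto
  ultimately show ?thesis using B(2) by (simp add: card_image)
qed

lemma copy_degree_Inl:
  assumes "i \<in> I" "c < k - 1"
  shows "card {e \<in> copy_edge ` copies. Inl (i, c) \<in> e} = v"
proof -
  have "{z \<in> copies. Inl (i, c) \<in> copy_edge z} = Pair i ` Pair c ` cls i"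
    unfolding Inl_copy_edge copies_def using assms by auto
  then show ?thesis
    using card_cls[OF assms(1)] by (simp add: card_copy_edges card_image inj_on_def)
qed

lemma copy_degree_Inr:
  assumes "x \<in> V"
  shows "card {e \<in> copy_edge ` copies. Inr x \<in> e} = v - 1"
proof -
  have "{z \<in> copies. Inr x \<in> copy_edge z} = (SIGMA i:I. {..<k - 1} \<times> {B \<in> cls i. x \<in> B})"
    unfolding Inr_copy_edge copies_def by auto
  also have "card \<dots> = (\<Sum>i\<in>I. card ({..<k - 1} \<times> {B \<in> cls i. x \<in> B}))"
    using finI finite_cls by (subst card_SigmaI) auto
  also have "\<dots> = (\<Sum>i\<in>I. (k - 1) * k)"
    using point_degree[OF _ assms] by (intro sum.cong) (auto simp: card_cartesian_product)
  also have "\<dots> = v - 1" using card_I by (simp add: mult_ac)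
  finally show ?thesis by (simp add: card_copy_edges)
qed

lemma copy_codegree_Inl_Inr:
  assumes "i \<in> I" "x \<in> V"
  shows "card {e \<in> copy_edge ` copies. Inl (i, c) \<in> e \<and> Inr x \<in> e} \<le> k"
proof -
  have "{z \<in> copies. Inl (i, c) \<in> copy_edge z \<and> Inr x \<in> copy_edge z} \<subseteq> Pair i ` Pair c ` {B \<in> cls i. x \<in> B}"
    unfolding Inl_copy_edge Inr_copy_edge copies_def by auto
  then have "card {z \<in> copies. Inl (i, c) \<in> copy_edge z \<and> Inr x \<in> copy_edge z} \<le> card (Pair i ` Pair c ` {B \<in> cls i. x \<in> B})"
    using finite_cls[OF assms(1)] by (intro card_mono) auto
  also have "\<dots> = k" using point_degree[OF assms] by (simp add: card_image inj_on_def)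
  finally show ?thesis by (simp add: card_copy_edges)
qed

text \<open>Only one block contains both points, and it gives one edge for each of the k - 1 copies
  of its orbit.\<close>

lemma copy_codegree_Inr:
  assumes "x \<noteq> y"
  shows "card {e \<in> copy_edge ` copies. Inr x \<in> e \<and> Inr y \<in> e} \<le> k"
proof -
  let ?S = "{z \<in> copies. Inr x \<in> copy_edge z \<and> Inr y \<in> copy_edge z}"
  have "card ?S \<le> card {..<k - 1}"
  proof (rule card_inj_on_le)
    show "inj_on (\<lambda>z. fst (snd z)) ?S"
    proof (rule inj_onI)
      fix z w assume z: "z \<in> ?S" and w: "w \<in> ?S" and eq: "fst (snd z) = fst (snd w)"
      have S: "fst u \<in> I" "snd (snd u) \<in> cls (fst u)" "x \<in> snd (snd u)" "y \<in> snd (snd u)" if "u \<in> ?S" for u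
        using that unfolding Inr_copy_edge copies_def by auto
      have "fst z = fst w \<and> snd (snd z) = snd (snd w)"
        by (rule unique[OF S(1)[OF z] S(1)[OF w] S(2)[OF z] S(2)[OF w] assms S(3,4)[OF z] S(3,4)[OF w]])
      then show "z = w" using eq by (simp add: prod_eq_iff)
    qed
  qed (auto simp: copies_def)
  then show ?thesis by (simp add: card_copy_edges)
qed

lemma copy_codegree:
  assumes "a \<in> copy_vertices" "b \<in> copy_vertices" "a \<noteq> b"
  shows "card {e \<in> copy_edge ` copies. a \<in> e \<and> b \<in> e} \<le> k"
proof (cases a)
  case (Inl p)
  obtain i c where a: "a = Inl (i, c)" "i \<in> I" using assms(1) Inl by (auto simp: copy_vertices_def)
  show ?thesis
  proof (cases b)
    case (Inl q)
    have "{e \<in> copy_edge ` copies. a \<in> e \<and> b \<in> e} = {}"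
      using assms(3) unfolding a Inl by (cases q) (auto simp: Inl_copy_edge)
    then show ?thesis by (simp only: card.empty)
  next
    case (Inr x)
    then have "x \<in> V" using assms(2) by (auto simp: copy_vertices_def)
    then show ?thesis using copy_codegree_Inl_Inr[OF a(2), of x c] unfolding a Inr by simp
  qed
next
  case (Inr x)
  then have x: "x \<in> V" using assms(1) by (auto simp: copy_vertices_def)
  show ?thesis
  proof (cases b)
    case (Inl q)
    then obtain i c where b: "b = Inl (i, c)" "i \<in> I" using assms(2) by (auto simp: copy_vertices_def)
    then show ?thesis using copy_codegree_Inl_Inr[OF b(2) x, of c] unfolding b Inr by (simp add: conj_commute)
  next
    case (Inr y)
    then show ?thesis using copy_codegree_Inr[of x y] assms(3) \<open>a = Inr x\<close> by simp
  qed
qed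

lemma finite_copy_vertices: "finite copy_vertices"
  using finI finV by (simp add: copy_vertices_def)

lemma card_copy_vertices: "card copy_vertices \<le> 2 * v"
proof -
  have "card copy_vertices \<le> card (Inl ` (I \<times> {..<k - 1}) :: ('i \<times> nat + 'a) set) + card (Inr ` V :: ('i \<times> nat + 'a) set)"
    unfolding copy_vertices_def by (rule card_Un_le)
  also have "\<dots> = card I * (k - 1) + v"
    using cardV by (simp add: card_image inj_on_def card_cartesian_product)
  also have "card I * (k - 1) \<le> card I * (k * (k - 1))"
    using k by (intro mult_le_mono2) simp
  also have "\<dots> \<le> v" using card_I by simp
  finally show ?thesis by simp
qed

lemma representatives_from_matching:
  assumes M: "M \<subseteq> copy_edge ` copies" "disjoint M"
    and room: "2 * (k * k + 2 * k * k * k) * (card (copy_vertices - \<Union>M) + 12 * k + 12) < v"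
  shows "\<exists>f. (\<forall>i\<in>I. f i \<in> cls i) \<and> (\<forall>i\<in>I. \<forall>j\<in>I. i \<noteq> j \<longrightarrow> f i \<inter> f j = {})"
proof -
  define P where "P = {i \<in> I. \<forall>c<k - 1. Inl (i, c) \<in> \<Union>M}"
  have "\<exists>B. copy_edge (i, c, B) \<in> M \<and> B \<in> cls i" if i: "i \<in> P" and c: "c < k - 1" for i c
  proof -
    obtain e where e: "e \<in> M" "Inl (i, c) \<in> e" using i c unfolding P_def by blast
    then obtain z where z: "z \<in> copies" "e = copy_edge z" using M(1) by blast
    have "fst z = i" "fst (snd z) = c" using e(2) unfolding z(2) Inl_copy_edge by simp_all
    then have "z = (i, c, snd (snd z))" by (simp add: prod_eq_iff)
    moreover have "snd (snd z) \<in> cls i" using z(1) \<open>fst z = i\<close> unfolding copies_def by auto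
    ultimately show ?thesis using e(1) z(2) by metis
  qed
  then have "\<forall>p\<in>P \<times> {..<k - 1}. \<exists>B. copy_edge (fst p, snd p, B) \<in> M \<and> B \<in> cls (fst p)" by auto
  from bchoice[OF this] obtain g where g: "\<forall>p\<in>P \<times> {..<k - 1}. copy_edge (fst p, snd p, g p) \<in> M \<and> g p \<in> cls (fst p)" ..
  have g': "copy_edge (i, c, g (i, c)) \<in> M" "g (i, c) \<in> cls i" if "i \<in> P" "c < k - 1" for i c
    using g that by auto
  \<comment> \<open>The blocks matched to copies 1 and 0 become the two slots.\<close>
  define s where "s i b = g (i, of_bool b)" for i b
  have k1: "of_bool b < k - 1" for b using k by (cases b) auto
  have PI: "P \<subseteq> I" by (auto simp: P_def)
  \<comment> \<open>Every orbit outside \<open>P\<close> has an uncovered copy of its own.\<close>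
  have "card (I - P) \<le> card (copy_vertices - \<Union>M)"
  proof -
    have "\<forall>i\<in>I - P. \<exists>c<k - 1. Inl (i, c) \<notin> \<Union>M" unfolding P_def by blast
    from bchoice[OF this] obtain h where h: "\<forall>i\<in>I - P. h i < k - 1 \<and> Inl (i, h i) \<notin> \<Union>M" ..
    show ?thesis
    proof (rule card_inj_on_le)
      show "inj_on (\<lambda>i. Inl (i, h i)) (I - P)" by (simp add: inj_on_def)
      show "(\<lambda>i. Inl (i, h i)) ` (I - P) \<subseteq> copy_vertices - \<Union>M" using h unfolding copy_vertices_def by blast
    qed (use finite_copy_vertices in simp)
  qed
  then have "2 * (k * k + 2 * k * k * k) * (card (I - P) + 12 * k + 12)
      \<le> 2 * (k * k + 2 * k * k * k) * (card (copy_vertices - \<Union>M) + 12 * k + 12)"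
    by (intro mult_le_mono2) simp
  from this room have room': "2 * (k * k + 2 * k * k * k) * (card (I - P) + 12 * k + 12) < v"
    by (rule le_less_trans)
  have "two_slots V I cls v k P s"
  proof (intro two_slots.intro two_slots_axioms.intro)
    show "orbit_system V I cls v k" by unfold_locales
    show "P \<subseteq> I" by (rule PI)
    show "s i b \<in> cls i" if "i \<in> P" for i b unfolding s_def by (rule g'(2)[OF that k1])
    show "s i b \<inter> s j c = {}" if "i \<in> P" "j \<in> P" "(i, b) \<noteq> (j, c)" for i j b c
    proof (rule ccontr)
      let ?z = "(i, of_bool b, s i b) :: 'i \<times> nat \<times> 'a set" and ?w = "(j, of_bool c, s j c) :: 'i \<times> nat \<times> 'a set"
      have M2: "copy_edge ?z \<in> M" "copy_edge ?w \<in> M" using g'(1)[OF that(1) k1] g'(1)[OF that(2) k1] unfolding s_def by auto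
      have "?z \<noteq> ?w" using that(3) by (auto split: if_splits simp: of_bool_def)
      then have "copy_edge ?z \<noteq> copy_edge ?w" using injD[OF inj_copy_edge] by blast
      then have "copy_edge ?z \<inter> copy_edge ?w = {}" using M(2) M2 by (simp add: disjoint_def)
      moreover assume "s i b \<inter> s j c \<noteq> {}"
      then obtain x where "x \<in> s i b" "x \<in> s j c" by blast
      then have "Inr x \<in> copy_edge ?z \<inter> copy_edge ?w" by (simp add: Inr_copy_edge)
      ultimately show False by blast
    qed
    show "2 * (k * k + 2 * k * k * k) * (card (I - P) + 12 * k + 12) < v" by (rule room')
  qed
  then show ?thesis by (rule two_slots.disjoint_representatives)
qed

end

theorem large_orbit_system:
  "\<exists>v0. \<forall>(V :: 'a set) (I :: 'i set) cls v. orbit_system V I cls v k \<longrightarrow> v0 \<le> v \<longrightarrow>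
    (\<exists>f. (\<forall>i\<in>I. f i \<in> cls i) \<and> (\<forall>i\<in>I. \<forall>j\<in>I. i \<noteq> j \<longrightarrow> f i \<inter> f j = {}))"
proof (cases "3 \<le> k")
  case False
  then have "\<not> orbit_system V I cls v k" for V :: "'a set" and I :: "'i set" and cls v
    by (simp add: orbit_system_def)
  then show ?thesis by simp
next
  case True
  define c where "c = k * k + 2 * k * k * k"
  have c: "0 < c" using True by (simp add: c_def)
  \<comment> \<open>There are at most 2 v vertices, so at most v / (4 c) stay uncovered. They
    account for at most v / 2 in \<open>room\<close>, and \<open>v0\<close> is such that 12 k + 12
    accounts for at most v / 4.\<close>
  define \<delta> where "\<delta> = 1 / (8 * real c)"
  have \<delta>: "0 < \<delta>" using c by (simp add: \<delta>_def)
  obtain T where T: "\<And>(W :: ('i \<times> nat + 'a) set) E (D :: real). finite W \<Longrightarrow> \<forall>e\<in>E. e \<subseteq> W \<and> card e = k + 1 \<Longrightarrow>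
    \<forall>x\<in>W. D - 1 \<le> degree_in E x \<and> degree_in E x \<le> D \<Longrightarrow>
    \<forall>x\<in>W. \<forall>y\<in>W. x \<noteq> y \<longrightarrow> card {e \<in> E. x \<in> e \<and> y \<in> e} \<le> k \<Longrightarrow> T \<le> D \<Longrightarrow>
    \<exists>M\<subseteq>E. disjoint M \<and> card (W - \<Union>M) \<le> \<delta> * card W"
    using near_perfect_matching[OF \<delta>, where 'a = "'i \<times> nat + 'a", of "k + 1" k] by blast
  define v0 where "v0 = max (nat \<lceil>T\<rceil>) (8 * c * (12 * k + 12))"
  show ?thesis
  proof (intro exI[of _ v0] allI impI)
    fix V :: "'a set" and I :: "'i set" and cls v
    assume sys: "orbit_system V I cls v k" and v0: "v0 \<le> v"
    interpret orbit_system V I cls v k by (rule sys)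
    have T_le: "T \<le> real v" using v0 unfolding v0_def by linarith
    have deg: "\<forall>x\<in>copy_vertices. real v - 1 \<le> degree_in (copy_edge ` copies) x \<and> degree_in (copy_edge ` copies) x \<le> real v"
    proof
      fix x assume "x \<in> copy_vertices"
      then consider i c where "x = Inl (i, c)" "i \<in> I" "c < k - 1" | y where "x = Inr y" "y \<in> V"
        by (auto simp: copy_vertices_def)
      then have "degree_in (copy_edge ` copies) x = v \<or> degree_in (copy_edge ` copies) x = v - 1"
        by cases (simp_all only: degree_in_def copy_degree_Inl copy_degree_Inr, simp_all)
      then show "real v - 1 \<le> degree_in (copy_edge ` copies) x \<and> degree_in (copy_edge ` copies) x \<le> real v"
        using v by (elim disjE) (simp_all add: of_nat_diff)
    qed
    have uni: "\<forall>e\<in>copy_edge ` copies. e \<subseteq> copy_vertices \<and> card e = k + 1"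
      by (intro ballI copy_edge_uniform)
    have codeg: "\<forall>x\<in>copy_vertices. \<forall>y\<in>copy_vertices. x \<noteq> y \<longrightarrow> card {e \<in> copy_edge ` copies. x \<in> e \<and> y \<in> e} \<le> k"
      by (intro ballI impI copy_codegree)
    obtain M where M: "M \<subseteq> copy_edge ` copies" "disjoint M" "card (copy_vertices - \<Union>M) \<le> \<delta> * card copy_vertices"
      using T[OF finite_copy_vertices uni deg codeg T_le] by (elim exE conjE)
    have "\<delta> * card copy_vertices \<le> \<delta> * (2 * real v)"
      using card_copy_vertices \<delta> by (intro mult_left_mono) linarith+
    with M(3) have "4 * real c * card (copy_vertices - \<Union>M) \<le> v"
      using c by (simp add: \<delta>_def field_simps)
    then have "real (4 * c * card (copy_vertices - \<Union>M)) \<le> v" by simp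
    then have "4 * c * card (copy_vertices - \<Union>M) \<le> v" by (simp only: of_nat_le_iff)
    moreover have "8 * c * (12 * k + 12) \<le> v" using v0 unfolding v0_def by simp
    ultimately have "2 * c * (card (copy_vertices - \<Union>M) + 12 * k + 12) < v"
      using v by (simp add: algebra_simps)
    then show "\<exists>f. (\<forall>i\<in>I. f i \<in> cls i) \<and> (\<forall>i\<in>I. \<forall>j\<in>I. i \<noteq> j \<longrightarrow> f i \<inter> f j = {})"
      unfolding c_def by (rule representatives_from_matching[OF M(1,2)])
  qed
qed

section \<open>Cyclic designs\<close>

locale full_cyclic_design =
  fixes v k :: nat and \<B> :: "int set multiset"
  assumes k: "3 \<le> k" and v: "0 < v" and cyclic: "cyclic_design v k 1 \<B>"
    and full: "\<forall>B\<in>#\<B>. full_orbit v B"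
begin

lemma Zmod_mod: "x mod int v \<in> Zmod v"
  using v by (simp add: Zmod_def)

lemma mod_Zmod: "x \<in> Zmod v \<Longrightarrow> x mod int v = x"
  by (simp add: Zmod_def)

lemma translate_image: "translate v s ` translate v t ` B = translate v ((t + s) mod int v) ` B"
proof -
  have "translate v s (translate v t x) = translate v ((t + s) mod int v) x" for x
    by (simp add: translate_def mod_simps add.assoc)
  then show ?thesis by (simp add: image_image)
qed

lemma translate_zero:
  assumes "B \<subseteq> Zmod v"
  shows "translate v 0 ` B = B"
proof -
  have "translate v 0 ` B = (\<lambda>x. x) ` B"
    using assms by (intro image_cong) (auto simp: translate_def mod_Zmod subset_iff)
  then show ?thesis by simp
qed

lemma block: "B \<in># \<B> \<Longrightarrow> B \<subseteq> Zmod v \<and> card B = k"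
  using cyclic by (simp add: cyclic_design_def design_def)

lemma finite_block: "B \<in># \<B> \<Longrightarrow> finite B"
  using block[of B] k card_ge_0_finite[of B] by simp

lemma pair_size: "x \<in> Zmod v \<Longrightarrow> y \<in> Zmod v \<Longrightarrow> x \<noteq> y \<Longrightarrow> size {#B \<in># \<B>. x \<in> B \<and> y \<in> B#} = 1"
  using cyclic by (simp add: cyclic_design_def design_def)

lemma pair_cover:
  assumes "x \<in> Zmod v" "y \<in> Zmod v" "x \<noteq> y"
  shows "\<exists>B\<in>#\<B>. x \<in> B \<and> y \<in> B"
proof -
  have "{#B \<in># \<B>. x \<in> B \<and> y \<in> B#} \<noteq> {#}"
    using pair_size[OF assms] by (metis size_empty zero_neq_one)
  then obtain B where "B \<in># {#B \<in># \<B>. x \<in> B \<and> y \<in> B#}" by (rule multiset_nonemptyE)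
  then show ?thesis by auto
qed

lemma pair_unique:
  assumes "B \<in># \<B>" "C \<in># \<B>" "x \<noteq> y" "x \<in> B" "y \<in> B" "x \<in> C" "y \<in> C"
  shows "B = C"
proof -
  have "x \<in> Zmod v" "y \<in> Zmod v" using block[OF assms(1)] assms by auto
  from pair_size[OF this assms(3)] obtain A where A: "{#B \<in># \<B>. x \<in> B \<and> y \<in> B#} = {#A#}"
    by (metis One_nat_def size_1_singleton_mset)
  have "B \<in># {#B \<in># \<B>. x \<in> B \<and> y \<in> B#}" "C \<in># {#B \<in># \<B>. x \<in> B \<and> y \<in> B#}"
    using assms by auto
  then show ?thesis unfolding A by simp
qed

text \<open>A repeated block would cover a pair of its points more than once, so the multiset of
  blocks is a set.\<close>

lemma count_block:
  assumes B: "B \<in># \<B>"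
  shows "count \<B> B = 1"
proof -
  have "\<not> card B \<le> Suc 0" using block[OF B] k by simp
  then obtain x y where xy: "x \<in> B" "y \<in> B" "x \<noteq> y"
    using card_le_Suc0_iff_eq[OF finite_block[OF B]] by blast
  have "count \<B> B = count {#B \<in># \<B>. x \<in> B \<and> y \<in> B#} B" using xy by simp
  also have "\<dots> \<le> size {#B \<in># \<B>. x \<in> B \<and> y \<in> B#}" by (rule count_le_size)
  also have "\<dots> = 1" using pair_size[of x y] xy block[OF B] by auto
  finally have "count \<B> B \<le> 1" .
  moreover have "0 < count \<B> B" using B by simp
  ultimately show ?thesis by linarith
qed

lemma translate_block:
  assumes "t \<in> Zmod v" "B \<in># \<B>"
  shows "translate v t ` B \<in># \<B>"
proof -
  have "image_mset ((`) (translate v t)) \<B> = \<B>"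
    using cyclic assms(1) by (simp add: cyclic_design_def design_automorphism_def)
  then have "set_mset \<B> = (`) (translate v t) ` set_mset \<B>" by (metis set_image_mset)
  then show ?thesis using assms(2) by blast
qed

lemma orbit_block: "B \<in># \<B> \<Longrightarrow> C \<in> block_orbit v B \<Longrightarrow> C \<in># \<B>"
  using translate_block by (auto simp: block_orbit_def)

lemma orbit_self: "B \<in># \<B> \<Longrightarrow> B \<in> block_orbit v B"
  using translate_zero[of B] block[of B] v by (auto simp: block_orbit_def Zmod_def intro!: exI[of _ 0])

lemma orbit_subset:
  assumes "C \<in> block_orbit v B"
  shows "block_orbit v C \<subseteq> block_orbit v B"
proof
  fix D assume "D \<in> block_orbit v C"
  then obtain s t where "C = translate v t ` B" "D = translate v s ` C"
    using assms by (auto simp: block_orbit_def)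
  then have "D = translate v ((t + s) mod int v) ` B" by (simp only: translate_image)
  then show "D \<in> block_orbit v B" unfolding block_orbit_def using Zmod_mod by blast
qed

lemma orbit_eq:
  assumes B: "B \<in># \<B>" and C: "C \<in> block_orbit v B"
  shows "block_orbit v C = block_orbit v B"
proof
  obtain t where t: "t \<in> Zmod v" "C = translate v t ` B" using C by (auto simp: block_orbit_def)
  have "translate v ((- t) mod int v) ` C = translate v 0 ` B"
    unfolding t(2) translate_image by (simp add: mod_simps)
  then have "B = translate v ((- t) mod int v) ` C" using translate_zero block[OF B] by simp
  then have "B \<in> block_orbit v C" using Zmod_mod unfolding block_orbit_def by blast
  then show "block_orbit v B \<subseteq> block_orbit v C" by (rule orbit_subset)
qed (rule orbit_subset[OF C])

lemma orbit_image: "block_orbit v B = (\<lambda>t. translate v t ` B) ` Zmod v"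
  by (auto simp: block_orbit_def)

lemma card_Zmod: "finite (Zmod v)" "card (Zmod v) = v"
  by (simp_all add: Zmod_def)

lemma card_orbit: "B \<in># \<B> \<Longrightarrow> card (block_orbit v B) = v"
  using full by (simp add: full_orbit_def)

text \<open>This is the form in which the absence of short orbits is used: different shifts of a
  block are different blocks.\<close>

lemma translate_inj: "B \<in># \<B> \<Longrightarrow> inj_on (\<lambda>t. translate v t ` B) (Zmod v)"
  using card_orbit[of B] card_Zmod by (intro eq_card_imp_inj_on) (simp_all add: orbit_image[symmetric])

definition "orbits = block_orbit v ` set_mset \<B>"

lemma orbitsE:
  assumes "i \<in> orbits" "B \<in> i"
  shows "B \<in># \<B>" "i = block_orbit v B"
proof -
  obtain C where C: "C \<in># \<B>" "i = block_orbit v C" using assms(1) by (auto simp: orbits_def)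
  show "B \<in># \<B>" using orbit_block C assms(2) by simp
  show "i = block_orbit v B" using orbit_eq C assms(2) by simp
qed

text \<open>The point x lies in B + t exactly when t belongs to x - B, and distinct t give distinct
  blocks.\<close>

lemma point_degree:
  assumes i: "i \<in> orbits" and x: "x \<in> Zmod v"
  shows "card {B \<in> i. x \<in> B} = k"
proof -
  obtain B where B: "B \<in># \<B>" "i = block_orbit v B" using i by (auto simp: orbits_def)
  have BZ: "B \<subseteq> Zmod v" "card B = k" using block[OF B(1)] by auto
  have iff: "x \<in> translate v t ` B \<longleftrightarrow> t \<in> (\<lambda>y. (x - y) mod int v) ` B" if t: "t \<in> Zmod v" for t
  proof
    assume "x \<in> translate v t ` B"
    then obtain y where y: "y \<in> B" "x = (y + t) mod int v" by (auto simp: translate_def)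
    have "(x - y) mod int v = t" using mod_Zmod[OF t] unfolding y(2) by (simp add: mod_simps)
    then show "t \<in> (\<lambda>y. (x - y) mod int v) ` B" using y(1) by blast
  next
    assume "t \<in> (\<lambda>y. (x - y) mod int v) ` B"
    then obtain y where y: "y \<in> B" "t = (x - y) mod int v" by blast
    have "translate v t y = x" using mod_Zmod[OF x] unfolding y(2) translate_def by (simp add: mod_simps)
    then show "x \<in> translate v t ` B" using y(1) by blast
  qed
  have "{t \<in> Zmod v. x \<in> translate v t ` B} = (\<lambda>y. (x - y) mod int v) ` B"
    using iff Zmod_mod by blast
  then have "{B \<in> i. x \<in> B} = (\<lambda>t. translate v t ` B) ` ((\<lambda>y. (x - y) mod int v) ` B)"
    unfolding B(2) orbit_image Compr_image_eq by simp
  moreover have "inj_on (\<lambda>y. (x - y) mod int v) B"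
  proof (rule inj_onI)
    fix y z assume yz: "y \<in> B" "z \<in> B" "(x - y) mod int v = (x - z) mod int v"
    have "(x - (x - y) mod int v) mod int v = (x - (x - z) mod int v) mod int v" using yz(3) by simp
    then have "y mod int v = z mod int v" by (simp add: mod_simps)
    moreover have "y \<in> Zmod v" "z \<in> Zmod v" using yz(1,2) BZ(1) by blast+
    ultimately show "y = z" by (simp only: mod_Zmod)
  qed
  moreover have "inj_on (\<lambda>t. translate v t ` B) ((\<lambda>y. (x - y) mod int v) ` B)"
    by (rule inj_on_subset[OF translate_inj[OF B(1)]]) (use Zmod_mod in auto)
  ultimately show ?thesis using BZ by (simp add: card_image)
qed

text \<open>An orbit serves as its own index, so \<open>cls\<close> is the identity.\<close>

lemma orbit_system: "orbit_system (Zmod v) orbits (\<lambda>i. i) v k"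
proof
  show "finite orbits" by (simp add: orbits_def)
  show "B \<subseteq> Zmod v \<and> card B = k" if "i \<in> orbits" "B \<in> i" for i B
    by (rule block[OF orbitsE(1)[OF that]])
  show "card i = v" if "i \<in> orbits" for i using that card_orbit by (auto simp: orbits_def)
  show "\<exists>i\<in>orbits. \<exists>B\<in>i. x \<in> B \<and> y \<in> B" if "x \<in> Zmod v" "y \<in> Zmod v" "x \<noteq> y" for x y
    using pair_cover[OF that] orbit_self by (auto simp: orbits_def)
  show "i = j \<and> B = C" if "i \<in> orbits" "j \<in> orbits" "B \<in> i" "C \<in> j"
    "x \<noteq> y" "x \<in> B" "y \<in> B" "x \<in> C" "y \<in> C" for i j B C x y
  proof -
    have "B = C" by (rule pair_unique[OF orbitsE(1)[OF that(1,3)] orbitsE(1)[OF that(2,4)] that(5-9)])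
    then show ?thesis using orbitsE(2)[OF that(1,3)] orbitsE(2)[OF that(2,4)] by simp
  qed
qed (use k v card_Zmod point_degree in auto)

lemma difference_translate:
  assumes "x \<in> F" "y \<in> F" "d = (x - y) mod int v"
  shows "d \<in> translate v ((- y) mod int v) ` F" "0 \<in> translate v ((- y) mod int v) ` F"
proof -
  have "translate v ((- y) mod int v) x = d" "translate v ((- y) mod int v) y = 0"
    using assms(3) by (simp_all add: translate_def mod_simps)
  then show "d \<in> translate v ((- y) mod int v) ` F" "0 \<in> translate v ((- y) mod int v) ` F"
    using assms(1,2) by (metis imageI)+
qed

section \<open>Difference families from disjoint orbit representatives\<close>

context
  fixes f :: "int set set \<Rightarrow> int set"
  assumes rep: "\<And>i. i \<in> orbits \<Longrightarrow> f i \<in> i"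
    and disj: "\<And>i j. i \<in> orbits \<Longrightarrow> j \<in> orbits \<Longrightarrow> i \<noteq> j \<Longrightarrow> f i \<inter> f j = {}"
begin

lemma rep_block: "i \<in> orbits \<Longrightarrow> f i \<in># \<B>"
  using orbitsE(1) rep by blast

lemma rep_orbit: "i \<in> orbits \<Longrightarrow> block_orbit v (f i) = i"
  using orbitsE(2)[OF _ rep] by simp

lemma inj_rep: "inj_on f orbits"
  by (rule inj_onI) (metis rep_orbit)

lemma finite_orbits: "finite orbits"
  by (simp add: orbits_def)

text \<open>A difference d = x - y in a block means that its translate by -y contains d and 0
  (\<open>difference_translate\<close>). Exactly one block of the design contains both, and it is
  the translate of one representative by one shift, which determines y and then x.\<close>

lemma one_difference:
  assumes d: "d \<in> Zmod v - {0}"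
  shows "card (SIGMA i:orbits. {(x, y). x \<in> f i \<and> y \<in> f i \<and> x \<noteq> y \<and> (x - y) mod int v = d}) = 1"
proof -
  let ?S = "SIGMA i:orbits. {(x, y). x \<in> f i \<and> y \<in> f i \<and> x \<noteq> y \<and> (x - y) mod int v = d}"
  have "0 \<in> Zmod v" using v by (simp add: Zmod_def)
  then obtain B where B: "B \<in># \<B>" "d \<in> B" "0 \<in> B" using pair_cover[of d 0] d by auto
  let ?i = "block_orbit v B"
  have i: "?i \<in> orbits" using B(1) by (simp add: orbits_def)
  obtain t where t: "t \<in> Zmod v" "f ?i = translate v t ` B"
    using rep[OF i] unfolding orbit_image by blast
  let ?x = "translate v t d" and ?y = "translate v t 0"
  have diff: "(?x - ?y) mod int v = d" using d mod_Zmod by (simp add: translate_def mod_simps)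
  have "?x \<noteq> ?y" using diff d by auto
  then have mem: "(?i, ?x, ?y) \<in> ?S" using i B diff unfolding t(2)[symmetric] by (auto simp: t(2))
  have uniq: "p = q" if p: "p \<in> ?S" and q: "q \<in> ?S" for p q
  proof -
    obtain i x y where p': "p = (i, x, y)" by (cases p) auto
    obtain j z w where q': "q = (j, z, w)" by (cases q) auto
    have i: "i \<in> orbits" "x \<in> f i" "y \<in> f i" "(x - y) mod int v = d" using p unfolding p' by auto
    have j: "j \<in> orbits" "z \<in> f j" "w \<in> f j" "(z - w) mod int v = d" using q unfolding q' by auto
    have Z: "x \<in> Zmod v" "y \<in> Zmod v" "z \<in> Zmod v" "w \<in> Zmod v"
      using block[OF rep_block[OF i(1)]] block[OF rep_block[OF j(1)]] i j by auto
    let ?B = "translate v ((- y) mod int v) ` f i" and ?C = "translate v ((- w) mod int v) ` f j"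
    have BC: "?B = ?C"
    proof (rule pair_unique[of _ _ d 0])
      show "?B \<in># \<B>" by (rule translate_block[OF Zmod_mod rep_block[OF i(1)]])
      show "?C \<in># \<B>" by (rule translate_block[OF Zmod_mod rep_block[OF j(1)]])
    qed (use d difference_translate[OF i(2,3) i(4)[symmetric]] difference_translate[OF j(2,3) j(4)[symmetric]] in auto)
    have "?B \<in> block_orbit v (f i)" "?C \<in> block_orbit v (f j)" using Zmod_mod unfolding orbit_image by blast+
    then have "block_orbit v (f i) = block_orbit v (f j)"
      using orbit_eq[OF rep_block[OF i(1)]] orbit_eq[OF rep_block[OF j(1)]] BC by metis
    then have ij: "i = j" using rep_orbit[OF i(1)] rep_orbit[OF j(1)] by simp
    have "(- y) mod int v = (- w) mod int v"
      using inj_onD[OF translate_inj[OF rep_block[OF i(1)]] BC[folded ij] Zmod_mod Zmod_mod] .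
    then have "(- ((- y) mod int v)) mod int v = (- ((- w) mod int v)) mod int v" by simp
    then have yw: "y = w" using Z mod_Zmod by (simp add: mod_simps)
    have "(y + (x - y) mod int v) mod int v = (w + (z - w) mod int v) mod int v" using i(4) j(4) yw by simp
    then have "x = z" using Z mod_Zmod by (simp add: mod_simps)
    then show ?thesis using ij yw p' q' by simp
  qed
  have "?S = {(?i, ?x, ?y)}"
  proof
    show "?S \<subseteq> {(?i, ?x, ?y)}"
    proof
      fix p assume "p \<in> ?S"
      then have "p = (?i, ?x, ?y)" by (rule uniq[OF _ mem])
      then show "p \<in> {(?i, ?x, ?y)}" by (simp only: singleton_iff)
    qed
    show "{(?i, ?x, ?y)} \<subseteq> ?S" unfolding insert_subset using mem by (intro conjI empty_subsetI)
  qed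
  then show ?thesis by simp
qed

lemma representatives_difference_family:
  "disjoint_difference_family v k 1 (mset_set (f ` orbits))"
  unfolding disjoint_difference_family_def cyclic_difference_family_def
proof (intro conjI ballI)
  fix F assume "F \<in># mset_set (f ` orbits)"
  then obtain i where "i \<in> orbits" "F = f i" using finite_orbits by auto
  then show "F \<subseteq> Zmod v" "card F = k" using block[OF rep_block] by auto
next
  fix d assume d: "d \<in> Zmod v - {0}"
  let ?D = "\<lambda>F. {(x, y). x \<in> F \<and> y \<in> F \<and> x \<noteq> y}"
  have fin: "finite (?D (f i))" if "i \<in> orbits" for i
    by (rule finite_subset[of _ "f i \<times> f i"]) (use finite_block[OF rep_block[OF that]] in auto)
  have "count (differences v (mset_set (f ` orbits))) d =
      (\<Sum>i\<in>orbits. count (image_mset (\<lambda>(x, y). (x - y) mod int v) (mset_set (?D (f i)))) d)"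
    unfolding differences_def sum_unfold_sum_mset[symmetric] count_sum sum.reindex[OF inj_rep] by simp
  also have "\<dots> = (\<Sum>i\<in>orbits. card {(x, y). x \<in> f i \<and> y \<in> f i \<and> x \<noteq> y \<and> (x - y) mod int v = d})"
  proof (rule sum.cong[OF refl])
    fix i assume i: "i \<in> orbits"
    have "count (image_mset (\<lambda>(x, y). (x - y) mod int v) (mset_set (?D (f i)))) d
      = (\<Sum>p | p \<in># mset_set (?D (f i)) \<and> d = (case p of (x, y) \<Rightarrow> (x - y) mod int v). count (mset_set (?D (f i))) p)"
      by (rule count_image_mset')
    also have "\<dots> = (\<Sum>p\<in>{p \<in> ?D (f i). d = (case p of (x, y) \<Rightarrow> (x - y) mod int v)}. 1)"
      using fin[OF i] by (intro sum.cong) auto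
    also have "\<dots> = card {p \<in> ?D (f i). d = (case p of (x, y) \<Rightarrow> (x - y) mod int v)}"
      by simp
    also have "{p \<in> ?D (f i). d = (case p of (x, y) \<Rightarrow> (x - y) mod int v)} =
      {(x, y). x \<in> f i \<and> y \<in> f i \<and> x \<noteq> y \<and> (x - y) mod int v = d}" by auto
    finally show "count (image_mset (\<lambda>(x, y). (x - y) mod int v) (mset_set (?D (f i)))) d
      = card {(x, y). x \<in> f i \<and> y \<in> f i \<and> x \<noteq> y \<and> (x - y) mod int v = d}" .
  qed
  also have "\<dots> = card (SIGMA i:orbits. {(x, y). x \<in> f i \<and> y \<in> f i \<and> x \<noteq> y \<and> (x - y) mod int v = d})"
  proof (rule card_SigmaI[symmetric, OF finite_orbits], intro ballI)
    fix i assume i: "i \<in> orbits"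
    show "finite {(x, y). x \<in> f i \<and> y \<in> f i \<and> x \<noteq> y \<and> (x - y) mod int v = d}"
      by (rule finite_subset[OF _ fin[OF i]]) auto
  qed
  also have "\<dots> = 1" by (rule one_difference[OF d])
  finally show "count (differences v (mset_set (f ` orbits))) d = 1" .
next
  fix F G assume F: "F \<in># mset_set (f ` orbits)" and G: "G \<in># mset_set (f ` orbits) - {#F#}"
  obtain i where i: "i \<in> orbits" "F = f i" using F finite_orbits by auto
  have "mset_set (f ` orbits) - {#F#} = mset_set (f ` orbits - {F})"
    using i finite_orbits by (simp add: mset_set_Diff)
  then have "G \<in> f ` orbits - {F}" using G finite_orbits by simp
  then obtain j where "j \<in> orbits" "G = f j" "G \<noteq> F" by auto
  then show "F \<inter> G = {}" using disj[of i j] i by auto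
qed

text \<open>Every multiplicity is 0 or 1 on both sides: a block occurs once in the design, lies in
  one orbit, and is reached there by one shift.\<close>

lemma representatives_generate: "generated_by v \<B> (mset_set (f ` orbits))"
  unfolding generated_by_def
proof (rule multiset_eqI)
  fix B
  have "count (\<Sum>F\<in>#mset_set (f ` orbits). {#translate v t ` F. t \<in># mset_set (Zmod v)#}) B
    = (\<Sum>i\<in>orbits. count {#translate v t ` f i. t \<in># mset_set (Zmod v)#} B)"
    unfolding sum_unfold_sum_mset[symmetric] count_sum sum.reindex[OF inj_rep] by simp
  also have "\<dots> = (\<Sum>i\<in>orbits. if B \<in> i then 1 else 0)"
  proof (rule sum.cong[OF refl])
    fix i assume i: "i \<in> orbits"
    have "{#translate v t ` f i. t \<in># mset_set (Zmod v)#} = mset_set (block_orbit v (f i))"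
      unfolding orbit_image by (rule image_mset_mset_set[OF translate_inj[OF rep_block[OF i]]])
    also have "block_orbit v (f i) = i" by (rule rep_orbit[OF i])
    finally show "count {#translate v t ` f i. t \<in># mset_set (Zmod v)#} B = (if B \<in> i then 1 else 0)"
      using card_orbit[OF rep_block[OF i]] v card_ge_0_finite[of i] by (simp add: rep_orbit[OF i] count_mset_set')
  qed
  also have "\<dots> = card {i \<in> orbits. B \<in> i}"
    using finite_orbits by (simp add: sum.If_cases Int_def)
  also have "\<dots> = count \<B> B"
  proof (cases "B \<in># \<B>")
    case True
    have "block_orbit v B \<in> orbits" using True unfolding orbits_def by (rule imageI)
    then have "{i \<in> orbits. B \<in> i} = {block_orbit v B}"
      using orbitsE(2)[of _ B] orbit_self[OF True] by blast
    then show ?thesis using count_block[OF True] by simp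
  next
    case False
    then have "{i \<in> orbits. B \<in> i} = {}" using orbitsE(1) by blast
    moreover have "count \<B> B = 0" using False by (simp add: not_in_iff)
    ultimately show ?thesis by (simp only: card.empty)
  qed
  finally show "count \<B> B = count (\<Sum>F\<in>#mset_set (f ` orbits). {#translate v t ` F. t \<in># mset_set (Zmod v)#}) B" ..
qed

end

section \<open>Representatives for prime v, for v = 1, and the conclusion\<close>

lemma prime_representatives:
  assumes p: "prime v"
  shows "\<exists>f. (\<forall>i\<in>orbits. f i \<in> i) \<and> (\<forall>i\<in>orbits. \<forall>j\<in>orbits. i \<noteq> j \<longrightarrow> f i \<inter> f j = {})"
proof -
  have fin: "finite orbits" by (simp add: orbits_def)
  \<comment> \<open>\<open>prime_disjoint_translates\<close> takes blocks indexed by natural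
    numbers; \<open>h\<close> numbers the orbits and \<open>e\<close> inverts the numbering.\<close>
  obtain h where h: "bij_betw h orbits {..<card orbits}"
    using ex_bij_betw_finite_nat[OF fin] by (auto simp: atLeast0LessThan)
  define e where "e = inv_into orbits h"
  have e: "e n \<in> orbits" if "n < card orbits" for n
    unfolding e_def using bij_betw_apply[OF bij_betw_inv_into[OF h]] that by simp
  have eh: "e (h i) = i" "h i < card orbits" if "i \<in> orbits" for i
    unfolding e_def using bij_betw_inv_into_left[OF h that] bij_betw_apply[OF h that] by simp_all
  have "\<forall>i\<in>orbits. \<exists>B. B \<in># \<B> \<and> i = block_orbit v B" by (auto simp: orbits_def)
  from bchoice[OF this] obtain g where "\<forall>i\<in>orbits. g i \<in># \<B> \<and> i = block_orbit v (g i)" ..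
  then have g: "g i \<in># \<B>" "block_orbit v (g i) = i" if "i \<in> orbits" for i using that by blast+
  have v_eq: "v = card orbits * (k * (k - 1)) + 1"
    using orbit_system.card_I[OF orbit_system] v by simp
  have "finite (g (e n)) \<and> card (g (e n)) = k" if "n < card orbits" for n
    using block[OF g(1)[OF e[OF that]]] finite_block[OF g(1)[OF e[OF that]]] by simp
  from prime_disjoint_translates[of v k "card orbits" "\<lambda>n. g (e n)", OF p k v_eq this] obtain t :: "nat \<Rightarrow> nat" where
    t: "\<forall>i<card orbits. \<forall>j<card orbits. i \<noteq> j \<longrightarrow>
      (\<forall>x\<in>g (e i). \<forall>y\<in>g (e j). \<not> int v dvd (x + int (t i)) - (y + int (t j)))" by (rule exE)
  define f where "f i = translate v (int (t (h i)) mod int v) ` g i" for i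
  have f_in: "f i \<in> i" if i: "i \<in> orbits" for i
  proof -
    have "f i \<in> block_orbit v (g i)" unfolding f_def orbit_image using Zmod_mod by blast
    then show ?thesis unfolding g(2)[OF i] .
  qed
  have f_disj: "f i \<inter> f j = {}" if ij: "i \<in> orbits" "j \<in> orbits" "i \<noteq> j" for i j
  proof (rule ccontr)
    assume "f i \<inter> f j \<noteq> {}"
    then obtain z where z: "z \<in> f i" "z \<in> f j" by blast
    obtain x where x: "x \<in> g i" "z = translate v (int (t (h i)) mod int v) x"
      using z(1) unfolding f_def by (rule imageE)
    obtain y where y: "y \<in> g j" "z = translate v (int (t (h j)) mod int v) y"
      using z(2) unfolding f_def by (rule imageE)
    have xy: "x \<in> g i" "y \<in> g j"
      "translate v (int (t (h i)) mod int v) x = translate v (int (t (h j)) mod int v) y"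
      using x y by simp_all
    from xy(3) have "(x + int (t (h i))) mod int v = (y + int (t (h j))) mod int v"
      by (simp only: translate_def mod_add_right_eq)
    then have dvd: "int v dvd (x + int (t (h i))) - (y + int (t (h j)))" by (rule iffD1[OF mod_eq_dvd_iff])
    have ne: "h i \<noteq> h j" using eh(1)[OF ij(1)] eh(1)[OF ij(2)] ij(3)
      by metis
    have "x \<in> g (e (h i))" "y \<in> g (e (h j))" using xy(1,2) eh(1)[OF ij(1)] eh(1)[OF ij(2)] by simp_all
    with t[rule_format, OF eh(2)[OF ij(1)] eh(2)[OF ij(2)] ne]
    have "\<not> int v dvd (x + int (t (h i))) - (y + int (t (h j)))" .
    with dvd show False by contradiction
  qed
  show ?thesis by (intro exI[of _ f] conjI ballI impI f_in f_disj)
qed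

text \<open>By \<open>card_I\<close> there are no orbits at all. Settling this case separately keeps
  1, which is not composite, out of the exceptional set.\<close>

lemma unit_representatives:
  assumes "v = 1"
  shows "\<exists>f. (\<forall>i\<in>orbits. f i \<in> i) \<and> (\<forall>i\<in>orbits. \<forall>j\<in>orbits. i \<noteq> j \<longrightarrow> f i \<inter> f j = {})"
proof -
  have "card orbits = 0" using orbit_system.card_I[OF orbit_system] assms k by simp
  moreover have "finite orbits" by (simp add: orbits_def)
  ultimately have "orbits = {}" by (metis card_0_eq)
  then show ?thesis by simp
qed

end

theorem corollary1:
  fixes k :: nat
  assumes "k \<ge> 3"
  shows "\<exists>E :: nat set. finite E \<and> (\<forall>n\<in>E. n > 1 \<and> \<not> prime n) \<and>
    (\<forall>v :: nat. v > 0 \<and> v \<notin> E \<longrightarrow>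
      (\<forall>\<B> :: int set multiset. cyclic_design v k 1 \<B> \<and> (\<forall>B\<in>#\<B>. full_orbit v B) \<longrightarrow>
        (\<exists>\<F> :: int set multiset. disjoint_difference_family v k 1 \<F> \<and> generated_by v \<B> \<F>)))"
proof -
  obtain v0 where large: "\<And>(V :: int set) (I :: int set set set) cls v. orbit_system V I cls v k \<Longrightarrow> v0 \<le> v \<Longrightarrow>
    \<exists>f. (\<forall>i\<in>I. f i \<in> cls i) \<and> (\<forall>i\<in>I. \<forall>j\<in>I. i \<noteq> j \<longrightarrow> f i \<inter> f j = {})"
    using large_orbit_system[where 'a = int and 'i = "int set set" and k = k] by blast
  let ?E = "{n. 1 < n \<and> n < v0 \<and> \<not> prime n}"
  show ?thesis
  proof (intro exI[of _ ?E] conjI allI impI)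
    show "finite ?E" by simp
    fix v :: nat and \<B> :: "int set multiset"
    assume vE: "v > 0 \<and> v \<notin> ?E" and \<B>: "cyclic_design v k 1 \<B> \<and> (\<forall>B\<in>#\<B>. full_orbit v B)"
    interpret full_cyclic_design v k \<B>
      using assms vE \<B> by unfold_locales auto
    have "v = 1 \<or> prime v \<or> v0 \<le> v" using vE by auto
    then have "\<exists>f. (\<forall>i\<in>orbits. f i \<in> i) \<and> (\<forall>i\<in>orbits. \<forall>j\<in>orbits. i \<noteq> j \<longrightarrow> f i \<inter> f j = {})"
      by (elim disjE) (rule unit_representatives prime_representatives large[OF orbit_system], assumption)+
    then obtain f where f: "\<forall>i\<in>orbits. f i \<in> i" "\<forall>i\<in>orbits. \<forall>j\<in>orbits. i \<noteq> j \<longrightarrow> f i \<inter> f j = {}"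
      by (elim exE conjE)
    have "disjoint_difference_family v k 1 (mset_set (f ` orbits))"
      by (rule representatives_difference_family) (simp_all add: f)
    moreover have "generated_by v \<B> (mset_set (f ` orbits))"
      by (rule representatives_generate) (simp_all add: f)
    ultimately show "\<exists>\<F> :: int set multiset. disjoint_difference_family v k 1 \<F> \<and> generated_by v \<B> \<F>" by blast
  qed auto
qed

end
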